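(* For all integers $n\ge 1$ and $t\ge 0$, there exist an integer $k\ge 0$ and a two-way entanglement purification protocol (2-EPP) producing $k$ EPR pairs from $n$ EPR pairs with up to $t$ errors, such that $$k \ \geq\ n - \log_2\left[\sum_{j=0}^{t} 3^j \binom{n}{j}\right] - 2 .$$
   Context: An EPR pair is a two-qubit state $\frac{1}{\sqrt2}(|00\rangle+|11\rangle)$, with the first qubit held by Alice and the second by Bob. In an entanglement purification protocol on $n$ pairs, Alice prepares $n$ EPR pairs and sends the second half of each to Bob through a noisy quantum channel, which acts on the $n$ transmitted qubits. Alice and Bob then process their qubits by local quantum operations (including measurements) and communication over noiseless classical channels. The protocol is a two-way protocol (2-EPP) if classical communication is allowed in both directions, so that each local operation may depend on all measurement results communicated so far. At the end the parties output pairs of qubits (one qubit of each pair with Alice, one with Bob). A 2-EPP produces $k$ EPR pairs from $n$ pairs with up to $t$ errors if, for every channel of the form $\mathcal{S}\otimes I$, where $\mathcal{S}$ is an arbitrary superoperator (quantum channel) acting on some set of at most $t$ of the $n$ transmitted qubits (the set being unknown to Alice and Bob) and $I$ is the identity on the remaining transmitted qubits, the protocol always (with probability 1) outputs at least $k$ pairs that are exactly (fidelity 1) in the state of perfect EPR pairs. The protocol may depend on $n$ and $t$ but not on the set of affected qubits or on $\mathcal{S}$. The case $k=0$ is trivially achievable. Convention: $\binom{n}{j}=0$ for $j>n$. *)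

theory Defs
  imports Complex_Main "Jordan_Normal_Form.Schur_Decomposition"
begin

section \<open>Finite-dimensional quantum operations\<close>

definition mat_trace :: "complex mat \<Rightarrow> complex" where
  "mat_trace A = (\<Sum>i<dim_row A. A $$ (i, i))"

definition msum :: "nat \<Rightarrow> complex mat list \<Rightarrow> complex mat" where
  "msum d As = mat d d (\<lambda>ij. \<Sum>A\<leftarrow>As. A $$ ij)"

definition tensor_mat :: "complex mat \<Rightarrow> complex mat \<Rightarrow> complex mat" where
  "tensor_mat A B = mat (dim_row A * dim_row B) (dim_col A * dim_col B)
     (\<lambda>(i, j). A $$ (i div dim_row B, j div dim_col B) * B $$ (i mod dim_row B, j mod dim_col B))"

text \<open>The Kraus operators \<open>Ks\<close> describe a superoperator (completely positive trace-preserving map)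
  from dimension \<open>d\<close> to dimension \<open>d'\<close>.\<close>

definition superoperator :: "nat \<Rightarrow> nat \<Rightarrow> complex mat list \<Rightarrow> bool" where
  "superoperator d d' Ks \<longleftrightarrow>
     set Ks \<subseteq> carrier_mat d' d \<and> msum d (map (\<lambda>K. mat_adjoint K * K) Ks) = 1\<^sub>m d"

definition apply_kraus :: "nat \<Rightarrow> complex mat list \<Rightarrow> complex mat \<Rightarrow> complex mat" where
  "apply_kraus d' Ks \<rho> = msum d' (map (\<lambda>K. K * \<rho> * mat_adjoint K) Ks)"


section \<open>Registers of qubits\<close>

text \<open>Basis states of an \<open>n\<close>-qubit register are the numbers \<open>x < 2 ^ n\<close>, the value of qubit \<open>q < n\<close>
  being \<open>bit x q\<close>.  In a bipartite system the basis state \<open>|x\<rangle>|y\<rangle>\<close>, with \<open>x\<close> held by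
  Alice and \<open>y\<close> by Bob, has index \<open>x * d + y\<close>, where \<open>d\<close> is the dimension of Bob's system; this is
  the ordering used in \<open>tensor_mat\<close>.\<close>

text \<open>Amplitudes of a single EPR pair, and of \<open>m\<close> EPR pairs whose \<open>q\<close>-th pair consists of
  Alice's \<open>q\<close>-th qubit and Bob's \<open>q\<close>-th qubit.\<close>

definition epr_amplitude :: "bool \<Rightarrow> bool \<Rightarrow> complex" where
  "epr_amplitude a b = (if a = b then 1 / complex_of_real (sqrt 2) else 0)"

definition epr_pairs :: "nat \<Rightarrow> complex vec" where
  "epr_pairs m = vec (2 ^ m * 2 ^ m)
     (\<lambda>i. \<Prod>q<m. epr_amplitude (bit (i div 2 ^ m) q) (bit (i mod 2 ^ m) q))"

definition epr_density :: "nat \<Rightarrow> complex mat" where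
  "epr_density m = mat (2 ^ m * 2 ^ m) (2 ^ m * 2 ^ m)
     (\<lambda>(i, j). epr_pairs m $ i * cnj (epr_pairs m $ j))"

text \<open>The basis state of the qubits in \<open>T\<close> (taken in increasing order) within the basis state \<open>x\<close>.\<close>

definition sub_register :: "nat set \<Rightarrow> nat \<Rightarrow> nat" where
  "sub_register T x = horner_sum of_bool 2 (map (bit x) (sorted_list_of_set T))"

text \<open>The operator that acts as \<open>E\<close> on the qubits in \<open>T\<close> and as the identity on the other qubits
  of an \<open>n\<close>-qubit register.\<close>

definition on_qubits :: "nat \<Rightarrow> nat set \<Rightarrow> complex mat \<Rightarrow> complex mat" where
  "on_qubits n T E = mat (2 ^ n) (2 ^ n)
     (\<lambda>(x, y). if \<forall>q<n. q \<notin> T \<longrightarrow> bit x q = bit y q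
               then E $$ (sub_register T x, sub_register T y) else 0)"

text \<open>Alice's halves of the \<open>n\<close> EPR pairs are untouched; Bob's halves pass through the channel with
  Kraus operators \<open>Es\<close> on the qubits in \<open>T\<close> and the identity elsewhere.\<close>

definition noisy_pairs :: "nat \<Rightarrow> nat set \<Rightarrow> complex mat list \<Rightarrow> complex mat" where
  "noisy_pairs n T Es =
     apply_kraus (2 ^ n * 2 ^ n) (map (\<lambda>E. tensor_mat (1\<^sub>m (2 ^ n)) (on_qubits n T E)) Es)
       (epr_density n)"


section \<open>Two-way entanglement purification protocols\<close>

datatype party = Alice | Bob

text \<open>In \<open>Local p d Kss next\<close>, party \<open>p\<close> performs a quantum instrument on its own system, mapping it
  to a system of dimension \<open>d\<close> (so that ancillas can be added and subsystems discarded).  Outcome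
  \<open>i < length Kss\<close> has the Kraus operators \<open>Kss ! i\<close> (several of them if part of the information is
  not communicated); it is announced to the other party, and the protocol continues with \<open>next i\<close>.
  A position in the tree thus records all results communicated so far, in both directions.
  \<open>Output m\<close> ends the protocol with \<open>m\<close> output pairs.\<close>

datatype protocol =
    Output nat
  | Local party nat "complex mat list list" "nat \<Rightarrow> protocol"

text \<open>\<open>well_formed P dA dB\<close>: \<open>P\<close> can be run when Alice's and Bob's systems have dimensions \<open>dA\<close> and
  \<open>dB\<close>.\<close>

primrec well_formed :: "protocol \<Rightarrow> nat \<Rightarrow> nat \<Rightarrow> bool" where
  "well_formed (Output m) dA dB \<longleftrightarrow> dA = 2 ^ m \<and> dB = 2 ^ m"
| "well_formed (Local p d Kss next) dA dB \<longleftrightarrow>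
     (case p of
        Alice \<Rightarrow> superoperator dA d (concat Kss) \<and> (\<forall>i<length Kss. well_formed (next i) d dB)
      | Bob \<Rightarrow> superoperator dB d (concat Kss) \<and> (\<forall>i<length Kss. well_formed (next i) dA d))"

text \<open>The possible final results: the number of output pairs together with the unnormalized joint
  state, whose trace is the probability of the branch.\<close>

primrec results :: "protocol \<Rightarrow> nat \<Rightarrow> nat \<Rightarrow> complex mat \<Rightarrow> (nat \<times> complex mat) set" where
  "results (Output m) dA dB \<rho> = {(m, \<rho>)}"
| "results (Local p d Kss next) dA dB \<rho> =
     (case p of
        Alice \<Rightarrow> (\<Union>i<length Kss. results (next i) d dB
                   (apply_kraus (d * dB) (map (\<lambda>K. tensor_mat K (1\<^sub>m dB)) (Kss ! i)) \<rho>))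
      | Bob \<Rightarrow> (\<Union>i<length Kss. results (next i) dA d
                   (apply_kraus (dA * d) (map (\<lambda>K. tensor_mat (1\<^sub>m dA) K) (Kss ! i)) \<rho>)))"

definition two_way_epp :: "nat \<Rightarrow> protocol \<Rightarrow> bool" where
  "two_way_epp n P \<longleftrightarrow> well_formed P (2 ^ n) (2 ^ n)"

definition produces_epr :: "protocol \<Rightarrow> nat \<Rightarrow> nat \<Rightarrow> nat \<Rightarrow> bool" where
  "produces_epr P n t k \<longleftrightarrow>
     (\<forall>T Es. T \<subseteq> {..<n} \<and> card T \<le> t \<and> superoperator (2 ^ card T) (2 ^ card T) Es \<longrightarrow>
        (\<forall>(m, \<rho>) \<in> results P (2 ^ n) (2 ^ n) (noisy_pairs n T Es).
           mat_trace \<rho> \<noteq> 0 \<longrightarrow>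
             k \<le> m \<and> inverse (mat_trace \<rho>) \<cdot>\<^sub>m \<rho> = epr_density m))"

end

theory Submission
  imports Defs "HOL-Library.FuncSet" "HOL-Library.Nat_Bijection"
begin

text \<open>After the channel, Bob's error is a linear combination of the Pauli errors of weight at most
  \<open>t\<close>, of which there are at most \<open>\<Sum>j\<le>t. 3 ^ j * (n choose j)\<close>. If Alice and Bob both measure a Pauli
  operator \<open>g\<close>, the comparison of their outcomes tells whether the error commutes with \<open>g\<close>; this costs
  one pair, and on the eigenspaces of \<open>g\<close> the remaining candidates are again elements of a Pauli group.
  Choosing \<open>g\<close> adaptively, the set of candidates is nearly halved each time. For a set of \<open>M\<close> candidates
  the average over \<open>g\<close> of the squared difference of the two parts is \<open>M\<close>, and for the trivial \<open>g\<close> it is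
  \<open>M\<^sup>2\<close>, so that some \<open>g\<close> does strictly better than \<open>\<surd>M\<close>. The accumulated loss of this argument slightly
  exceeds the two measurements at our disposal; it is repaired for \<open>M = 8\<close> and \<open>M = 15\<close>, where
  parity considerations (for 15 the values of a quadratic form) give an optimally balanced splitting.\<close>

section \<open>Balanced splittings by sign functions\<close>

text \<open>The two pairs lost beyond log2 M have separate causes. One pays for rounding M up to a
  power of two, the other for imperfect halving: \<open>s\<close> measurements are only guaranteed
  to resolve 2^(s-1) candidates instead of the ideal 2^s. A constant factor is enough because a set
  of L candidates is split with an imbalance of order sqrt L. The relative loss at level
  \<open>s\<close> is of order 2^(-s/2), which is summable, so most of it occurs at small sizes;
  this is why improving two small sizes rescues the bound. An arbitrary superoperator yields
  mixtures and coherent superpositions of Pauli errors, while the output must be certain and exact.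
  Hence the induction speaks of lists of operators in the complex span of the candidates, not of one
  random error: a pair of outcomes annihilates every candidate whose commutation sign disagrees with
  it, and the surviving ones act on the remaining space as members of a smaller error group.
  Proportional candidates need no separation, since a scalar disappears from the final state on
  normalization.\<close>

definition sign_group :: "('a \<Rightarrow> int) set \<Rightarrow> bool" where
  "sign_group F \<longleftrightarrow> finite F \<and> (\<lambda>_. 1) \<in> F \<and> (\<forall>f\<in>F. \<forall>a. f a = 1 \<or> f a = -1) \<and>
     (\<forall>f\<in>F. \<forall>g\<in>F. (\<lambda>a. f a * g a) \<in> F)"

lemma sign_groupD:
  assumes "sign_group F"
  shows "finite F" "(\<lambda>_. 1) \<in> F" "f \<in> F \<Longrightarrow> f a = 1 \<or> f a = -1"
    "f \<in> F \<Longrightarrow> g \<in> F \<Longrightarrow> (\<lambda>a. f a * g a) \<in> F" "f \<in> F \<Longrightarrow> f a * f a = 1"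
proof -
  show 3: "f a = 1 \<or> f a = -1" if "f \<in> F" for f a
    using assms that unfolding sign_group_def by blast
  show "f a * f a = 1" if "f \<in> F" for f a
    using 3[OF that, of a] by auto
qed (use assms in \<open>simp_all add: sign_group_def\<close>)

text \<open>Multiplication by \<open>u\<close> is an involution of \<open>F\<close>, so it only
  permutes the summands.\<close>

lemma sum_sign_group_translate:
  assumes F: "sign_group F" and u: "u \<in> F"
  shows "(\<Sum>f\<in>F. h (\<lambda>a. f a * u a)) = (\<Sum>f\<in>F. h f)"
proof (rule sum.reindex_bij_witness[where i = "\<lambda>f a. f a * u a" and j = "\<lambda>f a. f a * u a"])
  show "(\<lambda>a. f a * u a) \<in> F" if "f \<in> F" for f
    using sign_groupD(4)[OF F that u] .
  show "(\<lambda>a. f a * u a * u a) = f" if "f \<in> F" for f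
    using sign_groupD(5)[OF F u] by (simp add: mult.assoc)
  then show "(\<lambda>a. f a * u a * u a) = f" if "f \<in> F" for f
    using that by simp
qed (use sign_groupD(4)[OF F _ u] in auto)

text \<open>Parseval's identity. After expanding the square, a mixed term with a \<noteq> b sums to
  zero over \<open>F\<close>, because translating by a \<open>u\<close> that separates
  \<open>a\<close> from \<open>b\<close> reverses its sign; only the diagonal survives.\<close>

lemma sum_sq_signs:
  assumes F: "sign_group F" and S: "finite S"
    and sep: "\<And>a b. a \<in> S \<Longrightarrow> b \<in> S \<Longrightarrow> a \<noteq> b \<Longrightarrow> \<exists>f\<in>F. f a \<noteq> f b"
  shows "(\<Sum>f\<in>F. (\<Sum>a\<in>S. f a)\<^sup>2) = int (card F) * int (card S)"
proof -
  have orth: "(\<Sum>f\<in>F. f a * f b) = (if a = b then int (card F) else 0)" if "a \<in> S" "b \<in> S" for a b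
  proof (cases "a = b")
    case True
    then show ?thesis using sign_groupD(5)[OF F] by simp
  next
    case False
    then obtain u where u: "u \<in> F" "u a \<noteq> u b" using sep \<open>a \<in> S\<close> \<open>b \<in> S\<close> by blast
    then have "u a * u b = -1" using sign_groupD(3)[OF F u(1), of a] sign_groupD(3)[OF F u(1), of b] by auto
    then have "f a * u a * (f b * u b) = - (f a * f b)" for f
      by (metis mult.assoc mult.commute mult_minus1)
    then have "(\<Sum>f\<in>F. f a * f b) = - (\<Sum>f\<in>F. f a * f b)"
      using sum_sign_group_translate[OF F u(1), of "\<lambda>f. f a * f b"] by (simp add: sum_negf)
    then show ?thesis using False by simp
  qed
  have "(\<Sum>f\<in>F. (\<Sum>a\<in>S. f a)\<^sup>2) = (\<Sum>f\<in>F. \<Sum>a\<in>S. \<Sum>b\<in>S. f a * f b)"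
    by (simp add: power2_eq_square sum_product)
  also have "\<dots> = (\<Sum>a\<in>S. \<Sum>b\<in>S. \<Sum>f\<in>F. f a * f b)"
    by (subst sum.swap) (intro sum.cong refl sum.swap)
  also have "\<dots> = (\<Sum>a\<in>S. \<Sum>b\<in>S. if a = b then int (card F) else 0)"
    by (intro sum.cong refl) (simp add: orth)
  also have "\<dots> = int (card F) * int (card S)"
    using S by (simp add: sum.delta)
  finally show ?thesis .
qed

section \<open>Parities of the number of minus signs\<close>

definition negs :: "'a set \<Rightarrow> ('a \<Rightarrow> int) \<Rightarrow> nat" where
  "negs S f = card {a \<in> S. f a = -1}"

lemma negs_insert:
  assumes "finite S" "x \<notin> S"
  shows "negs (insert x S) f = (if f x = -1 then Suc (negs S f) else negs S f)"
proof -
  have "{a \<in> insert x S. f a = -1} = (if f x = -1 then insert x {a \<in> S. f a = -1} else {a \<in> S. f a = -1})"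
    by auto
  then show ?thesis using assms by (simp add: negs_def)
qed

lemma negs_empty [simp]: "negs {} f = 0"
  by (simp add: negs_def)

lemma sum_signs_negs:
  assumes "finite S" "\<forall>a. f a = 1 \<or> f a = -1"
  shows "(\<Sum>a\<in>S. f a) = int (card S) - 2 * int (negs S f)"
  using assms(1)
proof (induction S)
  case (insert x S)
  then show ?case using spec[OF assms(2), of x] by (auto simp: negs_insert)
qed simp

text \<open>The places where a product is -1 form the symmetric difference of those of its factors.
  The intersection is added on the left to avoid truncated subtraction.\<close>

lemma negs_mult:
  assumes "finite S" "\<forall>a. f a = 1 \<or> f a = -1" "\<forall>a. g a = 1 \<or> g a = -1"
  shows "negs S (\<lambda>a. f a * g a) + 2 * card {a \<in> S. f a = -1 \<and> g a = -1} = negs S f + negs S g"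
  using assms(1)
proof (induction S)
  case (insert x S)
  have eq: "{a \<in> insert x S. f a = -1 \<and> g a = -1} =
      (if f x = -1 \<and> g x = -1 then insert x {a \<in> S. f a = -1 \<and> g a = -1} else {a \<in> S. f a = -1 \<and> g a = -1})"
    by auto
  show ?case
    unfolding eq using spec[OF assms(2), of x] spec[OF assms(3), of x]
    by (elim disjE) (use insert in \<open>simp_all add: negs_insert\<close>)
qed simp

lemma even_negs_mult:
  assumes "finite S" "\<forall>a. f a = 1 \<or> f a = -1" "\<forall>a. g a = 1 \<or> g a = -1"
  shows "even (negs S (\<lambda>a. f a * g a)) \<longleftrightarrow> even (negs S f + negs S g)"
  using arg_cong[OF negs_mult[OF assms], of even] by simp

text \<open>The parity of the triangular number of \<open>negs S f\<close> is a quadratic form in \<open>f\<close>, and the bilinear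
  form \<open>polar\<close> below is its polarization.\<close>

definition tri :: "nat \<Rightarrow> nat" where "tri w = w * (w + 1) div 2"

lemma tri_eq: "2 * tri w = w * (w + 1)"
  unfolding tri_def by (simp add: even_two_times_div_two)

definition polar :: "'a set \<Rightarrow> ('a \<Rightarrow> int) \<Rightarrow> ('a \<Rightarrow> int) \<Rightarrow> nat" where
  "polar S f g = negs S f * negs S g + card {a \<in> S. f a = -1 \<and> g a = -1}"

text \<open>Let \<open>p\<close>, \<open>q\<close>, \<open>w\<close> count the minus signs of f, g
  and their product, and \<open>c\<close> the common ones. Substituting w = p + q - 2c into w(w+1)/2
  gives the triangular numbers of p and q, plus pq + c, plus an even remainder. The computation is
  done in the integers because of the subtraction.\<close>

lemma even_tri_mult:
  assumes "finite S" "\<forall>a. f a = 1 \<or> f a = -1" "\<forall>a. g a = 1 \<or> g a = -1"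
  shows "even (tri (negs S (\<lambda>a. f a * g a))) \<longleftrightarrow> even (tri (negs S f) + tri (negs S g) + polar S f g)"
proof -
  define w c p q where "w = negs S (\<lambda>a. f a * g a)" and "c = card {a \<in> S. f a = -1 \<and> g a = -1}"
    and "p = negs S f" and "q = negs S g"
  have eq: "w + 2 * c = p + q" using negs_mult[OF assms] by (simp add: w_def c_def p_def q_def)
  have wi: "int w = int p + int q - 2 * int c" using eq by linarith
  have t: "2 * int (tri w) = int w * (int w + 1)" for w
    using arg_cong[OF tri_eq[of w], of int] by (simp add: algebra_simps)
  have "2 * int (tri w) = 2 * int (tri p) + 2 * int (tri q) + 2 * (int p * int q)
     - 2 * int c * (2 * (int p + int q) + 1) + 4 * int c * int c"
    unfolding t wi by (simp add: algebra_simps)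
  then have "int (tri w) = int (tri p) + int (tri q) + (int p * int q + int c)
     + 2 * (int c * int c - int c * (int p + int q) - int c)"
    by (simp add: algebra_simps)
  then have "even (int (tri w)) \<longleftrightarrow> even (int (tri p) + int (tri q) + (int p * int q + int c))"
    by (metis dvd_add_left_iff dvd_triv_left)
  also have "int (tri p) + int (tri q) + (int p * int q + int c) = int (tri p + tri q + polar S f g)"
    by (simp add: polar_def p_def q_def c_def)
  finally show ?thesis by (simp only: even_of_nat w_def p_def q_def)
qed

text \<open>\<open>polar\<close> is additive modulo 2 in its second argument: both of its summands
  involve that argument only through a number of minus signs, taken over \<open>S\<close> or over
  the part of \<open>S\<close> where f = -1, and each such parity is additive.\<close>

lemma even_B_mult:
  assumes "finite S" "\<forall>a. g a = 1 \<or> g a = -1" "\<forall>a. h a = 1 \<or> h a = -1"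
  shows "even (polar S f (\<lambda>a. g a * h a)) \<longleftrightarrow> even (polar S f g + polar S f h)"
proof -
  let ?T = "{a \<in> S. f a = -1}"
  have c: "card {a \<in> S. f a = -1 \<and> k a = -1} = negs ?T k" for k
    unfolding negs_def by (rule arg_cong[of _ _ card]) auto
  have B: "even (polar S f k) \<longleftrightarrow> (even (negs S f) \<or> even (negs S k)) = even (negs ?T k)" for k
    unfolding polar_def c by simp
  have T: "finite ?T" using assms(1) by simp
  have "even (negs ?T (\<lambda>a. g a * h a)) \<longleftrightarrow> even (negs ?T g) = even (negs ?T h)"
    using even_negs_mult[OF T assms(2,3)] by (simp only: even_add)
  moreover have "even (negs S (\<lambda>a. g a * h a)) \<longleftrightarrow> even (negs S g) = even (negs S h)"
    using even_negs_mult[OF assms] by (simp only: even_add)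
  moreover have "gh = (g = h) \<Longrightarrow> GH = (G = H) \<Longrightarrow> ((F \<or> GH) = gh) = (((F \<or> G) = g) = ((F \<or> H) = h))"
    for F G H GH g h gh :: bool
    by (cases F; cases G; cases H; cases g; cases h) simp_all
  ultimately show ?thesis
    unfolding even_add B by (simp only:)
qed

text \<open>A quadratic form vanishing at the neutral element is even somewhere on each of a family of
  parallelograms, hence on at least a quarter of the group.\<close>

lemma exists_quad_even:
  assumes F: "sign_group F" and S: "finite S"
  obtains u v where "u \<in> F" "v \<in> F"
    "\<And>x. x \<in> F \<Longrightarrow> \<exists>y\<in>{x, \<lambda>a. x a * u a, \<lambda>a. x a * v a, \<lambda>a. x a * (u a * v a)}. even (tri (negs S y))"
proof -
  have pm: "\<forall>a. f a = 1 \<or> f a = -1" if "f \<in> F" for f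
    using sign_groupD(3)[OF F that] by blast
  let ?q = "\<lambda>f. tri (negs S f)"
  have one: "(\<lambda>_. 1) \<in> F" by (rule sign_groupD(2)[OF F])
  have mult: "even (?q (\<lambda>a. f a * g a)) \<longleftrightarrow> even (?q f + ?q g + polar S f g)" if "f \<in> F" "g \<in> F" for f g
    by (rule even_tri_mult[OF S pm[OF that(1)] pm[OF that(2)]])
  show thesis
  proof (cases "\<exists>u\<in>F. \<exists>v\<in>F. odd (polar S u v)")
    case True
    then obtain u v where u: "u \<in> F" and v: "v \<in> F" and o: "odd (polar S u v)" by blast
    have uv: "(\<lambda>a. u a * v a) \<in> F" by (rule sign_groupD(4)[OF F u v])
    show thesis
    proof (rule that[OF u v])
      fix x assume x: "x \<in> F"
      have "even (polar S x (\<lambda>a. u a * v a)) \<longleftrightarrow> even (polar S x u + polar S x v)"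
        by (rule even_B_mult[OF S pm[OF u] pm[OF v]])
      moreover have "even (?q (\<lambda>a. u a * v a)) \<longleftrightarrow> even (?q u) \<noteq> even (?q v)"
        using mult[OF u v] o by simp
      \<comment> \<open>The four values add up to \<open>polar S u v\<close> modulo 2, all other
        terms occurring an even number of times. The total is odd, so the four values cannot all be
        odd.\<close>
      ultimately have "even (?q x) \<or> even (?q (\<lambda>a. x a * u a)) \<or> even (?q (\<lambda>a. x a * v a))
          \<or> even (?q (\<lambda>a. x a * (u a * v a)))"
        using mult[OF x u] mult[OF x v] mult[OF x uv]
        by (cases "even (?q u)"; cases "even (?q v)"; cases "even (polar S x u)"; cases "even (polar S x v)")
          simp_all
      then show "\<exists>y\<in>{x, \<lambda>a. x a * u a, \<lambda>a. x a * v a, \<lambda>a. x a * (u a * v a)}. even (?q y)"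
        by (simp only: bex_simps simp_thms)
    qed
  next
    case nB: False
    show thesis
    proof (cases "\<forall>f\<in>F. even (?q f)")
      case True
      show thesis
        by (rule that[OF one one], rule bexI[OF _ insertI1]) (rule bspec[OF True])
    next
      case False
      then obtain u where u: "u \<in> F" "odd (?q u)" by blast
      show thesis
      proof (rule that[OF u(1) one])
        fix x assume "x \<in> F"
        moreover from this have "even (polar S x u)" using nB u by blast
        ultimately have "even (?q x) \<or> even (?q (\<lambda>a. x a * u a))"
          using mult[of x u] u by simp
        then show "\<exists>y\<in>{x, \<lambda>a. x a * u a, \<lambda>a. x a * 1, \<lambda>a. x a * (u a * 1)}. even (?q y)"
          by (simp only: bex_simps simp_thms mult_1_right)
      qed
    qed
  qed
qed

section \<open>Averaging arguments over the sign group\<close>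

lemma exists_small_sum:
  assumes F: "sign_group F" and S: "finite S" "card S \<ge> 2"
    and sep: "\<And>a b. a \<in> S \<Longrightarrow> b \<in> S \<Longrightarrow> a \<noteq> b \<Longrightarrow> \<exists>f\<in>F. f a \<noteq> f b"
  shows "\<exists>f\<in>F. (\<Sum>a\<in>S. f a)\<^sup>2 < int (card S)"
proof (rule ccontr)
  assume "\<not> ?thesis"
  then have ge: "int (card S) \<le> (\<Sum>a\<in>S. f a)\<^sup>2" if "f \<in> F" for f using that by force
  have one: "(\<lambda>_. 1) \<in> F" and fin: "finite F" using sign_groupD[OF F] by auto
  have "int (card S) < (\<Sum>a\<in>S. 1 :: int)\<^sup>2" using S by (simp add: power2_eq_square)
  then have "(\<Sum>f\<in>F. int (card S)) < (\<Sum>f\<in>F. (\<Sum>a\<in>S. f a)\<^sup>2)"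
    by (intro sum_strict_mono_ex1 fin ballI ge) (use one in \<open>auto intro!: bexI[of _ "\<lambda>_. 1"]\<close>)
  then show False using sum_sq_signs[OF F S(1) sep] by simp
qed

text \<open>The two exceptional sizes, where averaging alone would leave a part that is too large by one.\<close>

lemma exists_zero_sum_8:
  assumes F: "sign_group F" and S: "finite S" "card S = 8"
    and sep: "\<And>a b. a \<in> S \<Longrightarrow> b \<in> S \<Longrightarrow> a \<noteq> b \<Longrightarrow> \<exists>f\<in>F. f a \<noteq> f b"
  shows "\<exists>f\<in>F. (\<Sum>a\<in>S. f a) = 0"
proof (rule ccontr)
  assume no: "\<not> ?thesis"
  let ?X = "\<lambda>f. \<Sum>a\<in>S. f a"
  have pm: "\<forall>a. f a = 1 \<or> f a = -1" if "f \<in> F" for f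
    using sign_groupD(3)[OF F that] by blast
  have X: "?X f = 8 - 2 * int (negs S f)" if "f \<in> F" for f
    using sum_signs_negs[OF S(1) pm[OF that]] S(2) by simp
  have nz: "?X f \<noteq> 0" if "f \<in> F" for f using no that by blast
  have sq: "(?X f)\<^sup>2 \<ge> k\<^sup>2" if "\<bar>?X f\<bar> \<ge> k" "k \<ge> 0" for k :: int and f
    using power_mono[of k "\<bar>?X f\<bar>" 2] that by simp
  have two: "(?X f)\<^sup>2 \<ge> 4" if "f \<in> F" for f
  proof -
    have "\<bar>?X f\<bar> \<ge> 2" using X[OF that] nz[OF that] by presburger
    then show ?thesis using sq[of 2 f] by simp
  qed
  have four: "(?X f)\<^sup>2 \<ge> 16" if "f \<in> F" "even (negs S f)" for f
  proof -
    from that(2) obtain k where "negs S f = 2 * k" by blast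
    then have "\<bar>?X f\<bar> \<ge> 4" using X[OF \<open>f \<in> F\<close>] nz[OF \<open>f \<in> F\<close>] by presburger
    then show ?thesis using sq[of 4 f] by simp
  qed
  \<comment> \<open>The parity of the number of minus signs is a homomorphism on \<open>F\<close>,
    so it is constantly even or changed by some \<open>u\<close>.\<close>
  obtain u where u: "u \<in> F" and ev: "\<And>x. x \<in> F \<Longrightarrow> even (negs S x) \<or> even (negs S (\<lambda>a. x a * u a))"
  proof (cases "\<forall>f\<in>F. even (negs S f)")
    case True
    then show ?thesis using that sign_groupD(2)[OF F] by blast
  next
    case False
    then obtain u where "u \<in> F" "odd (negs S u)" by blast
    then show ?thesis using that[of u] even_negs_mult[OF S(1) pm pm]
      by (metis even_add)
  qed
  have fin: "finite F" and ne: "F \<noteq> {}" using sign_groupD[OF F] by auto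
  \<comment> \<open>In each pair one sum is a non-zero multiple of 4 and the other a non-zero even
    number: 16 + 4 = 20 exceeds 2 * 8, the pair average forced by Parseval.\<close>
  have ge: "20 \<le> (?X f)\<^sup>2 + (?X (\<lambda>a. f a * u a))\<^sup>2" if "f \<in> F" for f
    using ev[OF that] two[OF that] four[OF that] two[OF sign_groupD(4)[OF F that u]]
      four[OF sign_groupD(4)[OF F that u]] by linarith
  have "(\<Sum>f\<in>F. 20) \<le> (\<Sum>f\<in>F. (?X f)\<^sup>2 + (?X (\<lambda>a. f a * u a))\<^sup>2)"
    by (intro sum_mono ge)
  also have "\<dots> = 16 * int (card F)"
    using sum_sign_group_translate[OF F u, of "\<lambda>f. (?X f)\<^sup>2"] sum_sq_signs[OF F S(1) sep] S(2)
    by (simp add: sum.distrib)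
  finally show False using fin ne by (simp add: card_eq_0_iff)
qed

lemma exists_abs_sum_15:
  assumes F: "sign_group F" and S: "finite S" "card S = 15"
    and sep: "\<And>a b. a \<in> S \<Longrightarrow> b \<in> S \<Longrightarrow> a \<noteq> b \<Longrightarrow> \<exists>f\<in>F. f a \<noteq> f b"
  shows "\<exists>f\<in>F. \<bar>\<Sum>a\<in>S. f a\<bar> \<le> 1"
proof (rule ccontr)
  assume no: "\<not> ?thesis"
  let ?X = "\<lambda>f. \<Sum>a\<in>S. f a"
  have pm: "\<forall>a. f a = 1 \<or> f a = -1" if "f \<in> F" for f
    using sign_groupD(3)[OF F that] by blast
  have X: "?X f = 15 - 2 * int (negs S f)" if "f \<in> F" for f
    using sum_signs_negs[OF S(1) pm[OF that]] S(2) by simp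
  have nz: "\<bar>?X f\<bar> > 1" if "f \<in> F" for f using no that by force
  have sq: "(?X f)\<^sup>2 \<ge> k\<^sup>2" if "\<bar>?X f\<bar> \<ge> k" "k \<ge> 0" for k :: int and f
    using power_mono[of k "\<bar>?X f\<bar>" 2] that by simp
  have three: "(?X f)\<^sup>2 \<ge> 9" if "f \<in> F" for f
  proof -
    have "\<bar>?X f\<bar> \<ge> 3" using X[OF that] nz[OF that] by presburger
    then show ?thesis using sq[of 3 f] by simp
  qed
  \<comment> \<open>An even triangular number means 0 or 3 minus signs modulo 4, so the sum 15 - 2 *
    negs is 1 or -1 modulo 8. As the values 1 and -1 themselves are excluded, its modulus is at
    least 7.\<close>
  have seven: "(?X f)\<^sup>2 \<ge> 49" if "f \<in> F" "even (tri (negs S f))" for f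
  proof -
    have "negs S f mod 4 = 0 \<or> negs S f mod 4 = 3"
    proof -
      define w r q where "w = negs S f" and "r = w mod 4" and "q = w div 4"
      have w: "w = 4 * q + r" by (simp add: r_def q_def)
      from that(2) obtain k where "tri w = 2 * k" unfolding w_def by blast
      then have "4 dvd w * (w + 1)" using tri_eq[of w] by (intro dvdI[of _ _ k]) simp
      moreover have "w * (w + 1) = 4 * (q * (4 * q + 2 * r + 1)) + r * (r + 1)"
        unfolding w by (simp add: algebra_simps)
      ultimately have d: "4 dvd r * (r + 1)" by (simp only: dvd_add_right_iff[OF dvd_triv_left])
      have "r = 0 \<or> r = 1 \<or> r = 2 \<or> r = 3" unfolding r_def by presburger
      then show ?thesis using d unfolding w_def[symmetric] r_def[symmetric] by (auto simp flip: numeral_2_eq_2)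
    qed
    then have "\<bar>?X f\<bar> \<ge> 7" using X[OF that(1)] nz[OF that(1)] by presburger
    then show ?thesis using sq[of 7 f] by simp
  qed
  obtain u v where u: "u \<in> F" and v: "v \<in> F" and ev: "\<And>x. x \<in> F \<Longrightarrow>
      \<exists>y\<in>{x, \<lambda>a. x a * u a, \<lambda>a. x a * v a, \<lambda>a. x a * (u a * v a)}. even (tri (negs S y))"
    using exists_quad_even[OF F S(1)] by blast
  have uv: "(\<lambda>a. u a * v a) \<in> F" by (rule sign_groupD(4)[OF F u v])
  have fin: "finite F" and ne: "F \<noteq> {}" using sign_groupD[OF F] by auto
  note mF = sign_groupD(4)[OF F]
  \<comment> \<open>One of the four sums has modulus at least 7, the others at least 3: 49 + 3 * 9 =
    76, against a forced average of 4 * 15 = 60.\<close>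
  have ge: "76 \<le> (?X f)\<^sup>2 + (?X (\<lambda>a. f a * u a))\<^sup>2 + (?X (\<lambda>a. f a * v a))\<^sup>2
     + (?X (\<lambda>a. f a * (u a * v a)))\<^sup>2" if "f \<in> F" for f
  proof -
    have "even (tri (negs S f)) \<or> even (tri (negs S (\<lambda>a. f a * u a)))
        \<or> even (tri (negs S (\<lambda>a. f a * v a))) \<or> even (tri (negs S (\<lambda>a. f a * (u a * v a))))"
      using ev[OF that] by (simp only: bex_simps simp_thms)
    then have "49 \<le> (?X f)\<^sup>2 \<or> 49 \<le> (?X (\<lambda>a. f a * u a))\<^sup>2 \<or> 49 \<le> (?X (\<lambda>a. f a * v a))\<^sup>2
        \<or> 49 \<le> (?X (\<lambda>a. f a * (u a * v a)))\<^sup>2"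
      using seven[OF that] seven[OF mF[OF that u]] seven[OF mF[OF that v]] seven[OF mF[OF that uv]]
      by argo
    then show ?thesis
      using three[OF that] three[OF mF[OF that u]] three[OF mF[OF that v]] three[OF mF[OF that uv]]
      by linarith
  qed
  have "(\<Sum>f\<in>F. 76) \<le> (\<Sum>f\<in>F. (?X f)\<^sup>2 + (?X (\<lambda>a. f a * u a))\<^sup>2 + (?X (\<lambda>a. f a * v a))\<^sup>2
     + (?X (\<lambda>a. f a * (u a * v a)))\<^sup>2)"
    by (intro sum_mono ge)
  also have "\<dots> = 60 * int (card F)"
    using sum_sign_group_translate[OF F u, of "\<lambda>f. (?X f)\<^sup>2"] sum_sign_group_translate[OF F v, of "\<lambda>f. (?X f)\<^sup>2"]
      sum_sign_group_translate[OF F uv, of "\<lambda>f. (?X f)\<^sup>2"] sum_sq_signs[OF F S(1) sep] S(2)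
    by (simp add: sum.distrib)
  finally show False using fin ne by (simp add: card_eq_0_iff)
qed

text \<open>\<open>capacity s\<close> candidate errors can always be told apart by \<open>s\<close> adaptive measurements. Averaging
  allows the step from \<open>L\<close> to \<open>L'\<close> candidates if \<open>(2 L + 2 - L')\<^sup>2 \<ge> L'\<close>; apart from the steps to 8 and
  to 15, the values are chosen to satisfy this while staying above \<open>2 ^ (s - 1)\<close>.\<close>

definition capacity :: "nat \<Rightarrow> nat" where
  "capacity s = (if s < 4 then 2 ^ s
     else if even s then 8 * 4 ^ (s div 2 - 2) + 7 * 2 ^ (s div 2 - 2)
     else 16 * 4 ^ (s div 2 - 2) + 10 * 2 ^ (s div 2 - 2))"

lemma capacity_ge: "s \<ge> 1 \<Longrightarrow> 2 ^ (s - 1) \<le> capacity s"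
proof -
  assume "s \<ge> 1"
  show ?thesis
  proof (cases "s < 4")
    case True
    then show ?thesis by (simp add: capacity_def)
  next
    case False
    define i where "i = s div 2 - 2"
    have "s = 2 * i + 4 \<or> s = 2 * i + 5" using False unfolding i_def by presburger
    then show ?thesis
    proof
      assume s: "s = 2 * i + 4"
      have "(2::nat) ^ (s - 1) = 2 ^ (2 * i + 3)" unfolding s by simp
      also have "\<dots> = 8 * 4 ^ i" by (simp only: power_add power_mult) simp
      finally have "(2::nat) ^ (s - 1) = 8 * 4 ^ i" .
      then show ?thesis by (simp add: capacity_def s)
    next
      assume s: "s = 2 * i + 5"
      have "(2::nat) ^ (s - 1) = 2 ^ (2 * i + 4)" unfolding s by simp
      also have "\<dots> = 16 * 4 ^ i" by (simp only: power_add power_mult) simp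
      finally have "(2::nat) ^ (s - 1) = 16 * 4 ^ i" .
      then show ?thesis by (simp add: capacity_def s)
    qed
  qed
qed

text \<open>The two excluded steps are those from 4 to 8 and from 8 to 15. With x = 2^i the later
  steps compare (4x+2)^2 with 16x^2 + 10x and (6x+2)^2 with 32x^2 + 14x. The first conjunct guards
  the truncated subtraction in the second.\<close>

lemma capacity_Suc:
  assumes "s \<noteq> 2" "s \<noteq> 3"
  shows "capacity (Suc s) \<le> 2 * capacity s + 2 \<and>
    capacity (Suc s) \<le> (2 * capacity s + 2 - capacity (Suc s))\<^sup>2"
proof (cases "s < 4")
  case True
  then have "s = 0 \<or> s = 1" using assms by auto
  then show ?thesis by (auto simp: capacity_def power2_eq_square)
next
  case False
  define i where "i = s div 2 - 2"
  define x :: nat where "x = 2 ^ i"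
  have x2: "4 ^ i = x * x" unfolding x_def by (simp flip: power_mult_distrib)
  have "s = 2 * i + 4 \<or> s = 2 * i + 5" using False unfolding i_def by presburger
  then show ?thesis
  proof
    assume s: "s = 2 * i + 4"
    have 1: "capacity s = 8 * x * x + 7 * x" "capacity (Suc s) = 16 * x * x + 10 * x"
      by (auto simp: capacity_def s x2 x_def[symmetric])
    have "2 * capacity s + 2 - capacity (Suc s) = 4 * x + 2" unfolding 1 by simp
    then show ?thesis unfolding 1 by (simp add: power2_eq_square algebra_simps)
  next
    assume s: "s = 2 * i + 5"
    have e: "Suc s div 2 - 2 = i + 1" using s by presburger
    have 1: "capacity s = 16 * x * x + 10 * x" "capacity (Suc s) = 32 * x * x + 14 * x"
      unfolding capacity_def e by (simp_all add: s x2 x_def[symmetric])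
    have "2 * capacity s + 2 - capacity (Suc s) = 6 * x + 2" unfolding 1 by simp
    then show ?thesis unfolding 1 by (simp add: power2_eq_square algebra_simps)
  qed
qed

text \<open>The parts of a splitting have sizes (card S + X)/2 and (card S - X)/2, where X is the
  sum of signs; so bounding the larger part amounts to bounding the modulus of X.\<close>

lemma balanced_split:
  assumes F: "sign_group F" and S: "finite S" "2 \<le> card S" "card S \<le> capacity (Suc s)"
    and sep: "\<And>a b. a \<in> S \<Longrightarrow> b \<in> S \<Longrightarrow> a \<noteq> b \<Longrightarrow> \<exists>f\<in>F. f a \<noteq> f b"
  shows "\<exists>f\<in>F. card {a\<in>S. f a = 1} \<le> capacity s \<and> card {a\<in>S. f a = -1} \<le> capacity s"
proof -
  have pm: "\<forall>a. f a = 1 \<or> f a = -1" if "f \<in> F" for f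
    using sign_groupD(3)[OF F that] by blast
  have sums: "int (card {a\<in>S. f a = 1}) = int (card S) - int (negs S f)"
    "(\<Sum>a\<in>S. f a) = int (card S) - 2 * int (negs S f)" if "f \<in> F" for f
  proof -
    have "card S = card ({a\<in>S. f a = 1} \<union> {a\<in>S. f a = -1})"
      by (rule arg_cong[of _ _ card]) (use pm[OF that] in auto)
    also have "\<dots> = card {a\<in>S. f a = 1} + negs S f"
      unfolding negs_def by (rule card_Un_disjoint) (use S in auto)
    finally show "int (card {a\<in>S. f a = 1}) = int (card S) - int (negs S f)" by simp
  qed (rule sum_signs_negs[OF S(1) pm[OF that]])
  have small: "\<exists>f\<in>F. (\<Sum>a\<in>S. f a)\<^sup>2 < int (card S)" by (rule exists_small_sum[OF F S(1,2) sep])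
  have generic: ?thesis if L: "M' \<le> 2 * capacity s + 2" "M' \<le> (2 * capacity s + 2 - M')\<^sup>2" "card S \<le> M'" for M'
  proof -
    obtain f where f: "f \<in> F" and lt: "(\<Sum>a\<in>S. f a)\<^sup>2 < int (card S)" using small by blast
    \<comment> \<open>The summand 2 is the gain from integrality: if the modulus of the sum is less
      than \<open>D\<close>, the larger part is strictly below (M' + D)/2 =
      \<open>capacity s\<close> + 1, hence at most \<open>capacity s\<close>.\<close>
    define D where "D = int (2 * capacity s + 2 - M')"
    have D: "D = 2 * int (capacity s) + 2 - int M'" "int M' \<le> D\<^sup>2" "D \<ge> 0"
      using L(1) of_nat_mono[OF L(2), where 'a = int] unfolding D_def by (simp_all add: of_nat_diff)
    have "(\<Sum>a\<in>S. f a)\<^sup>2 < D\<^sup>2" using lt D L(3) by linarith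
    then have "\<bar>\<Sum>a\<in>S. f a\<bar> < D" using D(3) by (metis abs_of_nonneg power2_less_imp_less power2_abs)
    then have "int (card {a\<in>S. f a = 1}) \<le> int (capacity s)" "int (negs S f) \<le> int (capacity s)"
      using sums[OF f] D(1) L(3) by linarith+
    then show ?thesis using f unfolding negs_def by auto
  qed
  have c: "capacity 2 = 4" "capacity 3 = 8" "capacity 4 = 15" by (auto simp: capacity_def)
  \<comment> \<open>Only the top sizes 8 and 15 need the parity arguments. One below, averaging
    suffices: (10 - 7)^2 = 9 >= 7 and (18 - 14)^2 = 16 >= 14.\<close>
  consider "s = 2" "card S = 8" | "s = 2" "card S \<le> 7" | "s = 3" "card S = 15" | "s = 3" "card S \<le> 14"
    | "s \<noteq> 2" "s \<noteq> 3" using S(3) c by fastforce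
  then show ?thesis
  proof cases
    case 1
    obtain f where f: "f \<in> F" and z: "(\<Sum>a\<in>S. f a) = 0" using exists_zero_sum_8[OF F S(1) 1(2) sep] by blast
    show ?thesis by (rule bexI[OF _ f]) (use sums[OF f] z 1 c in \<open>auto simp: negs_def\<close>)
  next
    case 3
    obtain f where f: "f \<in> F" and z: "\<bar>\<Sum>a\<in>S. f a\<bar> \<le> 1" using exists_abs_sum_15[OF F S(1) 3(2) sep] by blast
    show ?thesis by (rule bexI[OF _ f]) (use sums[OF f] z 3 c in \<open>auto simp: negs_def\<close>)
  next
    case 2
    then show ?thesis using c by (intro generic[of 7]) auto
  next
    case 4
    then show ?thesis using c by (intro generic[of 14]) auto
  next
    case 5
    then show ?thesis using capacity_Suc[OF 5] S(3) by (intro generic[of "capacity (Suc s)"]) auto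
  qed
qed

section \<open>Adjoints and isometries\<close>

lemma dim_mat_adjoint [simp]:
  "dim_row (mat_adjoint A) = dim_col A" "dim_col (mat_adjoint A) = dim_row A"
  unfolding mat_adjoint_def by (auto simp: mat_of_rows_def)

lemma mat_adjoint_carrier [simp]: "(A :: complex mat) \<in> carrier_mat n m \<Longrightarrow> mat_adjoint A \<in> carrier_mat m n"
  by (auto intro!: carrier_matI)

lemma index_mat_adjoint [simp]:
  "i < dim_col A \<Longrightarrow> j < dim_row A \<Longrightarrow> mat_adjoint (A :: complex mat) $$ (i, j) = cnj (A $$ (j, i))"
  unfolding mat_adjoint_def by (simp add: mat_of_rows_def)

lemma index_mult_sum:
  "i < dim_row A \<Longrightarrow> j < dim_col B \<Longrightarrow> dim_col A = dim_row B \<Longrightarrow>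
    (A * B) $$ (i, j) = (\<Sum>k<dim_row B. A $$ (i, k) * B $$ (k, j))"
  by (simp add: scalar_prod_def atLeast0LessThan)

lemma mat_mult_assoc:
  "dim_col A = dim_row B \<Longrightarrow> dim_col B = dim_row C \<Longrightarrow> (A :: complex mat) * B * C = A * (B * C)"
  by (rule assoc_mult_mat) (auto intro!: carrier_matI)

lemma smult_mult: "(c \<cdot>\<^sub>m A) * B = c \<cdot>\<^sub>m (A * B)" if "dim_col A = dim_row B" for A B :: "complex mat"
  by (rule mult_smult_assoc_mat) (use that in \<open>auto intro!: carrier_matI\<close>)

lemma mult_smult: "A * (c \<cdot>\<^sub>m B) = c \<cdot>\<^sub>m (A * B)" if "dim_col A = dim_row B" for A B :: "complex mat"
  by (rule mult_smult_distrib) (use that in \<open>auto intro!: carrier_matI\<close>)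

lemma smult_smult: "c \<cdot>\<^sub>m (e \<cdot>\<^sub>m A) = (c * e) \<cdot>\<^sub>m (A :: complex mat)"
  by (intro eq_matI) auto

lemma smult_one: "1 \<cdot>\<^sub>m A = (A :: complex mat)"
  by (intro eq_matI) auto

lemma uminus_smult: "- A = (-1) \<cdot>\<^sub>m (A :: complex mat)"
  by (intro eq_matI) auto

lemma smult_add: "c \<cdot>\<^sub>m (A + B) = c \<cdot>\<^sub>m A + c \<cdot>\<^sub>m B" if "dim_row A = dim_row B" "dim_col A = dim_col B"
  for A B :: "complex mat"
  by (intro eq_matI) (use that in \<open>auto simp: algebra_simps\<close>)

lemma add_mult: "(A + B) * C = A * C + B * C"
  if "dim_row A = dim_row B" "dim_col A = dim_col B" "dim_col B = dim_row C" for A B :: "complex mat"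
  by (rule add_mult_distrib_mat) (use that in \<open>auto intro!: carrier_matI\<close>)

lemma mult_add: "A * (B + C) = A * B + A * C"
  if "dim_row B = dim_row C" "dim_col B = dim_col C" "dim_col A = dim_row C" for A B :: "complex mat"
  by (rule mult_add_distrib_mat) (use that in \<open>auto intro!: carrier_matI\<close>)

lemmas mat_algebra = mat_mult_assoc smult_mult mult_smult smult_smult smult_one uminus_smult
  smult_add add_mult mult_add

lemma adjoint_mult: "mat_adjoint (A * B) = mat_adjoint B * mat_adjoint A" if "dim_col A = dim_row B"
  for A B :: "complex mat"
  by (intro eq_matI) (use that in \<open>auto simp: index_mult_sum mult.commute simp del: index_mult_mat(1)\<close>)

lemma adjoint_adjoint [simp]: "mat_adjoint (mat_adjoint A) = (A :: complex mat)"
  by (intro eq_matI) auto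

lemma adjoint_smult: "mat_adjoint (c \<cdot>\<^sub>m A) = cnj c \<cdot>\<^sub>m mat_adjoint A"
  by (intro eq_matI) auto

lemma adjoint_add: "mat_adjoint (A + B) = mat_adjoint A + mat_adjoint B"
  if "dim_row A = dim_row B" "dim_col A = dim_col B" for A B :: "complex mat"
  by (intro eq_matI) (use that in auto)

lemma adjoint_one [simp]: "mat_adjoint (1\<^sub>m n) = (1\<^sub>m n :: complex mat)"
  by (intro eq_matI) auto

lemma mat_trace_mult_commute:
  assumes "A \<in> carrier_mat n m" "B \<in> carrier_mat m n"
  shows "mat_trace (A * B) = mat_trace (B * A)"
proof -
  have "mat_trace (A * B) = (\<Sum>i<n. \<Sum>k<m. A $$ (i, k) * B $$ (k, i))"
    unfolding mat_trace_def using assms by (intro sum.cong) (auto simp: index_mult_sum simp del: index_mult_mat(1))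
  also have "\<dots> = (\<Sum>k<m. \<Sum>i<n. B $$ (k, i) * A $$ (i, k))"
    by (subst sum.swap) (simp add: mult.commute)
  also have "\<dots> = mat_trace (B * A)"
    unfolding mat_trace_def using assms by (intro sum.cong) (auto simp: index_mult_sum simp del: index_mult_mat(1))
  finally show ?thesis .
qed

lemma adjoint_mult_index:
  assumes "i < dim_col A"
  shows "(mat_adjoint A * A) $$ (i, i) = of_real (\<Sum>k<dim_row A. (cmod (A $$ (k, i)))\<^sup>2)"
  using assms by (simp add: index_mult_sum complex_norm_square mult.commute del: index_mult_mat(1) of_real_power)

lemma append_isometry:
  fixes V v :: "complex mat"
  assumes V: "V \<in> carrier_mat d r" "mat_adjoint V * V = 1\<^sub>m r"
    and v: "v \<in> carrier_mat d 1" "mat_adjoint v * v = 1\<^sub>m 1"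
    and orth: "mat_adjoint V * v = 0\<^sub>m r 1"
  shows "\<exists>U\<in>carrier_mat d (Suc r). mat_adjoint U * U = 1\<^sub>m (Suc r) \<and>
     U * mat_adjoint U = V * mat_adjoint V + v * mat_adjoint v"
proof -
  define U where "U = mat d (Suc r) (\<lambda>(i, k). if k < r then V $$ (i, k) else v $$ (i, 0))"
  have U: "U \<in> carrier_mat d (Suc r)" by (simp add: U_def)
  have dims [simp]: "dim_row V = d" "dim_col V = r" "dim_row v = d" "dim_col v = Suc 0" "dim_row U = d"
      "dim_col U = Suc r"
    using V v U by auto
  have ent: "(\<Sum>k<d. cnj (V $$ (k, i)) * V $$ (k, j)) = (if i = j then 1 else 0)" if "i < r" "j < r" for i j
    using arg_cong[OF V(2), of "\<lambda>M. M $$ (i, j)"] that by (simp add: index_mult_sum del: index_mult_mat(1))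
  have ent_v: "(\<Sum>k<d. cnj (v $$ (k, 0)) * v $$ (k, 0)) = 1"
    using arg_cong[OF v(2), of "\<lambda>M. M $$ (0, 0)"] by (simp add: index_mult_sum del: index_mult_mat(1))
  have ent_o: "(\<Sum>k<d. cnj (V $$ (k, i)) * v $$ (k, 0)) = 0" if "i < r" for i
    using arg_cong[OF orth, of "\<lambda>M. M $$ (i, 0)"] that by (simp add: index_mult_sum del: index_mult_mat(1))
  have ent_o': "(\<Sum>k<d. cnj (v $$ (k, 0)) * V $$ (k, i)) = 0" if "i < r" for i
    using arg_cong[OF ent_o[OF that], of cnj] by (simp add: mult.commute)
  have "mat_adjoint U * U = 1\<^sub>m (Suc r)"
  proof (intro eq_matI)
    fix i j assume "i < dim_row (1\<^sub>m (Suc r) :: complex mat)" "j < dim_col (1\<^sub>m (Suc r) :: complex mat)"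
    then have ij: "i < Suc r" "j < Suc r" by auto
    have "(mat_adjoint U * U) $$ (i, j) = (\<Sum>k<d. cnj (U $$ (k, i)) * U $$ (k, j))"
      using ij by (simp add: index_mult_sum del: index_mult_mat(1))
    also have "\<dots> = (\<Sum>k<d. cnj (if i < r then V $$ (k, i) else v $$ (k, 0))
        * (if j < r then V $$ (k, j) else v $$ (k, 0)))"
      using ij by (intro sum.cong) (simp_all add: U_def)
    also have "\<dots> = (1\<^sub>m (Suc r) :: complex mat) $$ (i, j)"
      using ij by (auto simp: ent ent_v ent_o ent_o' less_Suc_eq)
    finally show "(mat_adjoint U * U) $$ (i, j) = (1\<^sub>m (Suc r) :: complex mat) $$ (i, j)" .
  qed auto
  moreover have "U * mat_adjoint U = V * mat_adjoint V + v * mat_adjoint v"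
  proof (intro eq_matI)
    fix i j assume "i < dim_row (V * mat_adjoint V + v * mat_adjoint v)"
      "j < dim_col (V * mat_adjoint V + v * mat_adjoint v)"
    then have ij: "i < d" "j < d" by auto
    have "(U * mat_adjoint U) $$ (i, j) = (\<Sum>k<Suc r. U $$ (i, k) * cnj (U $$ (j, k)))"
      using ij by (simp add: index_mult_sum del: index_mult_mat(1) sum.lessThan_Suc)
    also have "\<dots> = (\<Sum>k<r. V $$ (i, k) * cnj (V $$ (j, k))) + v $$ (i, 0) * cnj (v $$ (j, 0))"
      using ij by (simp add: U_def)
    also have "\<dots> = (V * mat_adjoint V + v * mat_adjoint v) $$ (i, j)"
      using ij by (simp add: index_mult_sum del: index_mult_mat(1))
    finally show "(U * mat_adjoint U) $$ (i, j) = (V * mat_adjoint V + v * mat_adjoint v) $$ (i, j)" .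
  qed auto
  ultimately show ?thesis using U by blast
qed

text \<open>Induction on the rank, read off as the trace. A normalized non-zero column of
  \<open>P\<close> is a unit vector in its range; subtracting the rank-one projector onto it leaves
  a projector of trace one less. For trace 0, the squared moduli of all entries add up to 0.\<close>

lemma projector_isometry:
  assumes "P \<in> carrier_mat d d" "P * P = P" "mat_adjoint P = P" "mat_trace P = of_nat r"
  shows "\<exists>V\<in>carrier_mat d r. mat_adjoint V * V = 1\<^sub>m r \<and> V * mat_adjoint V = P"
  using assms
proof (induction r arbitrary: P)
  case 0
  have dims [simp]: "dim_row P = d" "dim_col P = d" using 0 by auto
  have "of_nat 0 = mat_trace (mat_adjoint P * P)" using 0 by simp
  also have "\<dots> = of_real (\<Sum>i<d. \<Sum>k<d. (cmod (P $$ (k, i)))\<^sup>2)"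
    unfolding mat_trace_def by (simp add: adjoint_mult_index del: of_real_power index_mult_mat(1))
  finally have "of_real (\<Sum>i<d. \<Sum>k<d. (cmod (P $$ (k, i)))\<^sup>2) = (0 :: complex)"
    by (simp only: of_nat_0)
  then have "(\<Sum>i<d. \<Sum>k<d. (cmod (P $$ (k, i)))\<^sup>2) = 0" by (simp only: of_real_eq_0_iff)
  then have "\<forall>i<d. \<forall>k<d. P $$ (k, i) = 0"
    by (simp add: sum_nonneg_eq_0_iff sum_nonneg)
  then have P: "P = 0\<^sub>m d d" by (intro eq_matI) auto
  show ?case unfolding P by (intro bexI[of _ "0\<^sub>m d 0"] conjI eq_matI) (auto simp: scalar_prod_def)
next
  case (Suc r)
  have dims [simp]: "dim_row P = d" "dim_col P = d" using Suc.prems by auto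
  have "\<exists>j<d. P $$ (j, j) \<noteq> 0"
  proof (rule ccontr)
    assume "\<not> ?thesis"
    then have "mat_trace P = 0" unfolding mat_trace_def by simp
    then show False using Suc.prems(4) by (simp del: of_nat_Suc)
  qed
  then obtain j where j: "j < d" "P $$ (j, j) \<noteq> 0" by blast
  \<comment> \<open>Since \<open>P\<close> is a self-adjoint idempotent, its diagonal entry at
    \<open>j\<close> is the squared norm of column \<open>j\<close>; a non-zero diagonal entry,
    which exists as the trace is non-zero, therefore gives a column that can be normalized.\<close>
  define p where "p = (\<Sum>k<d. (cmod (P $$ (k, j)))\<^sup>2)"
  have Pj: "P $$ (j, j) = of_real p"
    using adjoint_mult_index[of j P] j Suc.prems by (simp add: p_def)
  have "p \<noteq> 0" using j(2) unfolding Pj by simp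
  moreover have "p \<ge> 0" unfolding p_def by (intro sum_nonneg) simp
  ultimately have p: "p > 0" by simp
  define v where "v = mat d 1 (\<lambda>(i, _). P $$ (i, j) / of_real (sqrt p))"
  have v: "v \<in> carrier_mat d 1" by (simp add: v_def)
  then have dv [simp]: "dim_row v = d" "dim_col v = Suc 0" by auto
  have sp: "complex_of_real (sqrt p) * complex_of_real (sqrt p) = of_real p"
    using p by (simp flip: of_real_mult)
  have vv: "mat_adjoint v * v = 1\<^sub>m 1"
  proof (intro eq_matI)
    fix i k assume "i < dim_row (1\<^sub>m 1 :: complex mat)" "k < dim_col (1\<^sub>m 1 :: complex mat)"
    then have [simp]: "i = 0" "k = 0" by auto
    have "(mat_adjoint v * v) $$ (0, 0) = (\<Sum>k<d. cnj (P $$ (k, j)) * P $$ (k, j)) / of_real p"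
      by (simp add: index_mult_sum v_def sum_divide_distrib sp del: index_mult_mat(1))
    also have "(\<Sum>k<d. cnj (P $$ (k, j)) * P $$ (k, j)) = of_real p"
      by (simp add: p_def complex_norm_square mult.commute del: of_real_power)
    finally show "(mat_adjoint v * v) $$ (i, k) = (1\<^sub>m 1 :: complex mat) $$ (i, k)" using p by simp
  qed auto
  have Pv: "P * v = v"
  proof (intro eq_matI)
    fix i k assume "i < dim_row v" "k < dim_col v"
    then have i: "i < d" "k = 0" by auto
    have "(P * v) $$ (i, k) = (\<Sum>l<d. P $$ (i, l) * P $$ (l, j)) / of_real (sqrt p)"
      using i by (simp add: index_mult_sum v_def sum_divide_distrib del: index_mult_mat(1))
    also have "(\<Sum>l<d. P $$ (i, l) * P $$ (l, j)) = (P * P) $$ (i, j)"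
      using i j by (simp add: index_mult_sum del: index_mult_mat(1))
    finally show "(P * v) $$ (i, k) = v $$ (i, k)" using i Suc.prems by (simp add: v_def)
  qed auto
  have vP: "mat_adjoint v * P = mat_adjoint v"
    using arg_cong[OF Pv, of mat_adjoint] Suc.prems(3) by (simp add: adjoint_mult)
  define W where "W = v * mat_adjoint v"
  define Q where "Q = P + (-1) \<cdot>\<^sub>m W"
  have dW [simp]: "dim_row W = d" "dim_col W = d" by (auto simp: W_def)
  have dQ [simp]: "dim_row Q = d" "dim_col Q = d" by (auto simp: Q_def)
  have "P * W = W" "W * P = W"
    unfolding W_def by (simp_all add: mat_mult_assoc vP) (simp flip: mat_mult_assoc add: Pv)
  moreover have WW: "W * W = W"
  proof -
    have "W * W = v * (mat_adjoint v * v) * mat_adjoint v" unfolding W_def by (simp add: mat_mult_assoc)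
    then show ?thesis unfolding vv by (simp add: W_def)
  qed
  ultimately have "Q * Q = P + (-1) \<cdot>\<^sub>m W + (-1) \<cdot>\<^sub>m (W + (-1) \<cdot>\<^sub>m W)"
    unfolding Q_def using Suc.prems(2) by (simp add: mat_algebra)
  also have "\<dots> = Q" unfolding Q_def by (intro eq_matI) auto
  finally have QQ: "Q * Q = Q" .
  have Qadj: "mat_adjoint Q = Q"
    unfolding Q_def W_def using Suc.prems(3) by (simp add: adjoint_add adjoint_smult adjoint_mult)
  have "mat_trace W = mat_trace (mat_adjoint v * v)"
    unfolding W_def by (rule mat_trace_mult_commute[of _ d 1]) (use v in auto)
  then have "mat_trace W = 1" unfolding vv by (simp add: mat_trace_def)
  moreover have "mat_trace Q = mat_trace P - mat_trace W"
    unfolding mat_trace_def Q_def by (simp add: sum_subtractf)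
  ultimately have "mat_trace Q = of_nat r" using Suc.prems(4) by simp
  moreover have "Q \<in> carrier_mat d d" by (intro carrier_matI) simp_all
  ultimately obtain V where V: "V \<in> carrier_mat d r" "mat_adjoint V * V = 1\<^sub>m r" "V * mat_adjoint V = Q"
    using Suc.IH[of Q] QQ Qadj by blast
  have dV [simp]: "dim_row V = d" "dim_col V = r" using V by auto
  have "Q * v = v + (-1) \<cdot>\<^sub>m (v * (mat_adjoint v * v))"
    unfolding Q_def W_def by (simp add: mat_algebra Pv)
  then have Qv: "Q * v = 0\<^sub>m d 1" unfolding vv by (intro eq_matI) auto
  \<comment> \<open>The new column is orthogonal to the old ones because \<open>Q\<close> kills
    \<open>v\<close> and \<open>V\<close> spans the range of \<open>Q\<close>.\<close>
  have "mat_adjoint V * v = (mat_adjoint V * V) * mat_adjoint V * v" unfolding V(2) by simp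
  also have "\<dots> = mat_adjoint V * (V * mat_adjoint V * v)" by (simp add: mat_mult_assoc)
  also have "\<dots> = 0\<^sub>m r 1" unfolding V(3) Qv by simp
  finally have orth: "mat_adjoint V * v = 0\<^sub>m r 1" .
  have "V * mat_adjoint V + v * mat_adjoint v = P"
    unfolding V(3) Q_def W_def[symmetric] by (intro eq_matI) auto
  then show ?case using append_isometry[OF V(1,2) v vv orth] by simp
qed

section \<open>Groups of errors\<close>

text \<open>An abstract Pauli group. No tensor structure is assumed, so that the notion passes to the
  eigenspaces of group elements.\<close>

definition error_group :: "nat \<Rightarrow> complex mat set \<Rightarrow> bool" where
  "error_group d G \<longleftrightarrow> 0 < d \<and> finite G \<and> G \<subseteq> carrier_mat d d \<and> 1\<^sub>m d \<in> G \<and>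
     (\<forall>A\<in>G. \<forall>B\<in>G. A * B \<in> G \<and> (A * B = B * A \<or> A * B = - (B * A))) \<and>
     (\<forall>A\<in>G. mat_adjoint A \<in> G \<and> (mat_adjoint A = A \<or> mat_adjoint A = - A) \<and> mat_adjoint A * A = 1\<^sub>m d) \<and>
     (\<forall>A\<in>G. (\<forall>B\<in>G. A * B = B * A) \<longrightarrow> (\<exists>c. A = c \<cdot>\<^sub>m 1\<^sub>m d))"

lemma error_groupD:
  assumes "error_group d G"
  shows "0 < d" "finite G" "1\<^sub>m d \<in> G"
    "A \<in> G \<Longrightarrow> dim_row A = d" "A \<in> G \<Longrightarrow> dim_col A = d" "A \<in> G \<Longrightarrow> A \<in> carrier_mat d d"
    "A \<in> G \<Longrightarrow> B \<in> G \<Longrightarrow> A * B \<in> G"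
    "A \<in> G \<Longrightarrow> B \<in> G \<Longrightarrow> A * B = B * A \<or> A * B = - (B * A)"
    "A \<in> G \<Longrightarrow> mat_adjoint A \<in> G" "A \<in> G \<Longrightarrow> mat_adjoint A = A \<or> mat_adjoint A = - A"
    "A \<in> G \<Longrightarrow> mat_adjoint A * A = 1\<^sub>m d" "A \<in> G \<Longrightarrow> A * mat_adjoint A = 1\<^sub>m d"
    "A \<in> G \<Longrightarrow> (\<And>B. B \<in> G \<Longrightarrow> A * B = B * A) \<Longrightarrow> \<exists>c. A = c \<cdot>\<^sub>m 1\<^sub>m d"
proof -
  show u: "mat_adjoint A * A = 1\<^sub>m d" and pm: "mat_adjoint A = A \<or> mat_adjoint A = - A" if "A \<in> G" for A
    using assms that unfolding error_group_def by blast+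
  show "A \<in> carrier_mat d d" if "A \<in> G" for A
    using assms that unfolding error_group_def by blast
  then show dims: "dim_row A = d" "dim_col A = d" if "A \<in> G" for A
    using that by blast+
  show "A * mat_adjoint A = 1\<^sub>m d" if "A \<in> G"
    using u[OF that] pm[OF that] dims[OF that] by (auto simp: uminus_smult mat_algebra)
qed (use assms in \<open>unfold error_group_def, blast+\<close>)

section \<open>Commutation signs\<close>

definition chi :: "complex mat \<Rightarrow> complex mat \<Rightarrow> int" where
  "chi A B = (if A * B = B * A then 1 else -1)"

lemma chi_pm: "chi A B = 1 \<or> chi A B = -1"
  by (simp add: chi_def)

lemma chi_commute: "chi A B = chi B A"
  by (auto simp: chi_def)

lemma smult_cancel:
  assumes "error_group d G" "A \<in> G" "c \<cdot>\<^sub>m A = e \<cdot>\<^sub>m A"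
  shows "c = e"
proof -
  note D = error_groupD[OF assms(1)]
  have "c \<cdot>\<^sub>m (mat_adjoint A * A) = e \<cdot>\<^sub>m (mat_adjoint A * A)"
    using arg_cong[OF assms(3), of "\<lambda>M. mat_adjoint A * M"] D(4,5)[OF assms(2)] by (simp add: mult_smult)
  then have "(c \<cdot>\<^sub>m 1\<^sub>m d) $$ (0, 0) = (e \<cdot>\<^sub>m 1\<^sub>m d) $$ (0, 0)" using D(11)[OF assms(2)] by simp
  then show ?thesis using D(1) by simp
qed

text \<open>Inside an error group the value -1, by definition mere non-commutation, means
  anticommutation.\<close>

lemma chi_eq:
  assumes "error_group d G" "A \<in> G" "B \<in> G"
  shows "A * B = of_int (chi A B) \<cdot>\<^sub>m (B * A)"
  using error_groupD(8)[OF assms] by (auto simp: chi_def smult_one uminus_smult)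

lemma chi_unique:
  assumes "error_group d G" "A \<in> G" "B \<in> G" "A * B = of_int c \<cdot>\<^sub>m (B * A)"
  shows "chi A B = c"
proof -
  have "of_int (chi A B) \<cdot>\<^sub>m (B * A) = of_int c \<cdot>\<^sub>m (B * A)"
    using chi_eq[OF assms(1-3)] assms(4) by simp
  then have "(of_int (chi A B) :: complex) = of_int c"
    by (rule smult_cancel[OF assms(1) error_groupD(7)[OF assms(1,3,2)]])
  then show ?thesis by simp
qed

lemma chi_mult:
  assumes "error_group d G" "A \<in> G" "B \<in> G" "C \<in> G"
  shows "chi A (B * C) = chi A B * chi A C"
proof (rule chi_unique[OF assms(1)])
  note D = error_groupD[OF assms(1)]
  note [simp] = D(4,5)[OF assms(2)] D(4,5)[OF assms(3)] D(4,5)[OF assms(4)]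
  have "A * (B * C) = (A * B) * C" by (simp add: mat_mult_assoc)
  also have "\<dots> = of_int (chi A B) \<cdot>\<^sub>m (B * (A * C))"
    unfolding chi_eq[OF assms(1-3)] by (simp add: smult_mult mat_mult_assoc)
  also have "\<dots> = of_int (chi A B * chi A C) \<cdot>\<^sub>m (B * C * A)"
    unfolding chi_eq[OF assms(1,2,4)] by (simp add: mat_algebra)
  finally show "A * (B * C) = of_int (chi A B * chi A C) \<cdot>\<^sub>m (B * C * A)" .
qed (use assms error_groupD(7)[OF assms(1)] in auto)

lemma chi_uminus: "chi (- A) B = chi A B" if "dim_col A = dim_row B" "dim_col B = dim_row A"
proof -
  have "(- A) * B = - (A * B)" "B * (- A) = - (B * A)" using that by auto
  then show ?thesis unfolding chi_def by (metis uminus_uminus_mat)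
qed

lemma chi_adjoint: "chi (mat_adjoint A) B = chi A B" if "error_group d G" "A \<in> G" "B \<in> G"
  using error_groupD(10)[OF that(1,2)] chi_uminus[of A B] error_groupD(4,5)[OF that(1,2)]
    error_groupD(4,5)[OF that(1,3)] by auto

lemma chi_mult_left:
  assumes "error_group d G" "A \<in> G" "B \<in> G" "C \<in> G"
  shows "chi (A * B) C = chi A C * chi B C"
  using chi_mult[OF assms(1,4,2,3)] chi_commute by metis

text \<open>If \<open>A\<close> and \<open>B\<close> had equal signs against all of
  \<open>G\<close>, then \<open>mat_adjoint B * A\<close> would commute with all of \<open>G\<close>
  and be a scalar by the condition on the centre; \<open>B\<close> being unitary, \<open>A\<close>
  would be proportional to \<open>B\<close>.\<close>

lemma chi_separates:
  assumes G: "error_group d G" "A \<in> G" "B \<in> G" and ne: "\<nexists>c. A = c \<cdot>\<^sub>m B"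
  shows "\<exists>C\<in>G. chi A C \<noteq> chi B C"
proof (rule ccontr)
  note D = error_groupD[OF G(1)]
  assume "\<not> ?thesis"
  then have eq: "chi A C = chi B C" if "C \<in> G" for C using that by blast
  let ?M = "mat_adjoint B * A"
  have B': "mat_adjoint B \<in> G" by (rule D(9)[OF G(3)])
  have "?M * C = C * ?M" if "C \<in> G" for C
  proof -
    have "chi ?M C = 1"
      using chi_mult_left[OF G(1) B' G(2) that] chi_adjoint[OF G(1,3) that] eq[OF that] chi_pm[of B C] by auto
    then show ?thesis unfolding chi_def by (auto split: if_splits)
  qed
  then obtain c where c: "?M = c \<cdot>\<^sub>m 1\<^sub>m d" using D(13)[OF D(7)[OF B' G(2)]] by blast
  note [simp] = D(4,5)[OF G(2)] D(4,5)[OF G(3)]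
  have "A = (B * mat_adjoint B) * A" unfolding D(12)[OF G(3)] by simp
  also have "\<dots> = B * ?M" by (simp add: mat_mult_assoc)
  also have "\<dots> = c \<cdot>\<^sub>m B" unfolding c by (simp add: mult_smult)
  finally show False using ne by blast
qed

text \<open>An \<open>h\<close> that anticommutes with \<open>g\<close> exchanges the two
  eigenspaces of \<open>g\<close>. Both thus have half the dimension, and when \<open>V\<close>
  parametrizes one of them, \<open>h * V\<close> parametrizes the other.\<close>

lemma eigenspace_isometry:
  assumes G: "error_group (2 * d) G" "g \<in> G" "h \<in> G" and anti: "chi h g = -1"
  obtains V e where "V \<in> carrier_mat (2 * d) d" "mat_adjoint V * V = 1\<^sub>m d" "e \<noteq> 0" "g * V = e \<cdot>\<^sub>m V"
    "mat_adjoint V * g = e \<cdot>\<^sub>m mat_adjoint V"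
    "V * mat_adjoint V + h * V * mat_adjoint (h * V) = 1\<^sub>m (2 * d)"
    "\<And>A. A \<in> G \<Longrightarrow> chi A g = 1 \<Longrightarrow> A * (V * mat_adjoint V) = (V * mat_adjoint V) * A"
proof -
  note D = error_groupD[OF G(1)]
  note [simp] = D(4,5)[OF G(2)] D(4,5)[OF G(3)]
  \<comment> \<open>Group elements may be skew-adjoint; the factor \<open>\<i>\<close> then makes
    \<open>H\<close> self-adjoint with square 1. The eigenvalue \<open>e\<close> of \<open>g\<close>
    is the inverse of this factor.\<close>
  define c :: complex where "c = (if mat_adjoint g = g then 1 else \<i>)"
  define H where "H = c \<cdot>\<^sub>m g"
  have dH [simp]: "dim_row H = 2 * d" "dim_col H = 2 * d" by (auto simp: H_def)
  have Hadj: "mat_adjoint H = H"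
    using D(10)[OF G(2)] by (auto simp: H_def c_def adjoint_smult uminus_smult smult_smult)
  have "cnj c * c = 1" by (simp add: c_def)
  have HH: "H * H = 1\<^sub>m (2 * d)"
  proof -
    have "H * H = mat_adjoint H * H" by (simp add: Hadj)
    also have "\<dots> = (cnj c * c) \<cdot>\<^sub>m (mat_adjoint g * g)"
      unfolding H_def by (simp add: adjoint_smult mat_algebra mult.commute)
    finally show ?thesis using D(11)[OF G(2)] \<open>cnj c * c = 1\<close> by (simp add: smult_one)
  qed
  have hH: "h * H = (-1) \<cdot>\<^sub>m (H * h)"
    using chi_eq[OF G(1,3,2)] anti unfolding H_def by (simp add: mat_algebra)
  have conj: "h * H * mat_adjoint h = (-1) \<cdot>\<^sub>m H"
    unfolding hH using D(12)[OF G(3)] by (simp add: mat_algebra)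
  \<comment> \<open>Conjugation by the unitary \<open>h\<close> preserves the trace but negates
    \<open>H\<close>.\<close>
  have trH: "mat_trace H = 0"
  proof -
    have "mat_trace (h * H * mat_adjoint h) = mat_trace (mat_adjoint h * (h * H))"
      by (rule mat_trace_mult_commute[of _ "2 * d" "2 * d"]) (auto intro: carrier_matI)
    also have "mat_adjoint h * (h * H) = (mat_adjoint h * h) * H" by (simp add: mat_mult_assoc)
    also have "\<dots> = H" unfolding D(11)[OF G(3)] by simp
    finally have "mat_trace ((-1) \<cdot>\<^sub>m H) = mat_trace H" unfolding conj .
    moreover have "mat_trace ((-1) \<cdot>\<^sub>m H) = - mat_trace H"
      unfolding mat_trace_def by (simp add: sum_negf)
    ultimately show ?thesis by simp
  qed
  define P where "P = (1/2) \<cdot>\<^sub>m (1\<^sub>m (2 * d) + H)"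
  have dP [simp]: "dim_row P = 2 * d" "dim_col P = 2 * d" by (auto simp: P_def)
  have "P * P = P"
    unfolding P_def by (simp add: mat_algebra HH) (intro eq_matI, auto)
  moreover have "mat_adjoint P = P"
    unfolding P_def by (simp add: adjoint_smult adjoint_add Hadj)
  moreover have "mat_trace P = of_nat d"
  proof -
    have "mat_trace P = (\<Sum>i<2 * d. (1/2) * (1 + H $$ (i, i)))"
      unfolding mat_trace_def by (intro sum.cong) (auto simp: P_def)
    also have "\<dots> = (1/2) * (\<Sum>i<2 * d. 1 + H $$ (i, i))"
      by (simp only: sum_distrib_left)
    also have "\<dots> = (1/2) * (of_nat (2 * d) + mat_trace H)"
      unfolding mat_trace_def by (simp add: sum.distrib)
    finally show ?thesis using trH by simp
  qed
  moreover have "P \<in> carrier_mat (2 * d) (2 * d)" by (intro carrier_matI) simp_all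
  ultimately obtain V where V: "V \<in> carrier_mat (2 * d) d" "mat_adjoint V * V = 1\<^sub>m d" "V * mat_adjoint V = P"
    using projector_isometry[of P "2 * d" d] by blast
  have dV [simp]: "dim_row V = 2 * d" "dim_col V = d" using V by auto
  have HP: "H * P = P" unfolding P_def by (simp add: mat_algebra HH) (intro eq_matI, auto)
  have V': "V = P * V"
  proof -
    have "P * V = V * (mat_adjoint V * V)" unfolding V(3)[symmetric] by (simp add: mat_mult_assoc)
    then show ?thesis unfolding V(2) by simp
  qed
  have HV: "H * V = V"
  proof -
    have "H * V = (H * P) * V" by (subst V') (simp add: mat_mult_assoc)
    then show ?thesis unfolding HP using V' by simp
  qed
  have VH: "mat_adjoint V * H = mat_adjoint V"
    using arg_cong[OF HV, of mat_adjoint] Hadj by (simp add: adjoint_mult)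
  have c: "c \<noteq> 0" by (simp add: c_def)
  have g: "g = inverse c \<cdot>\<^sub>m H" unfolding H_def smult_smult using c by (simp add: smult_one)
  show thesis
  proof (rule that[OF V(1,2), of "inverse c"])
    show "g * V = inverse c \<cdot>\<^sub>m V" "mat_adjoint V * g = inverse c \<cdot>\<^sub>m mat_adjoint V"
      unfolding g by (simp_all add: mat_algebra HV VH)
    have "h * V * mat_adjoint (h * V) = h * (V * mat_adjoint V) * mat_adjoint h"
      by (simp add: adjoint_mult mat_mult_assoc)
    also have "\<dots> = (1/2) \<cdot>\<^sub>m (h * mat_adjoint h + h * H * mat_adjoint h)"
      unfolding V(3) P_def by (simp add: mat_algebra)
    finally show "V * mat_adjoint V + h * V * mat_adjoint (h * V) = 1\<^sub>m (2 * d)"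
      unfolding V(3) conj D(12)[OF G(3)] P_def by (simp, intro eq_matI) (auto simp: field_simps)
    show "A * (V * mat_adjoint V) = (V * mat_adjoint V) * A" if "A \<in> G" "chi A g = 1" for A
      using chi_eq[OF G(1) that(1) G(2)] that(2) D(4,5)[OF that(1)]
      unfolding V(3) P_def H_def by (simp add: mat_algebra)
  qed (use c in auto)
qed

text \<open>Compression by \<open>V\<close> is multiplicative on the centralizer of
  \<open>g\<close>, whose members commute with the projector \<open>V * mat_adjoint V\<close>. The
  delicate point is the centre: an element central after compression commutes with the centralizer
  of \<open>g\<close> but perhaps not with \<open>h\<close>; multiplying it by \<open>g\<close>,
  which is a scalar on the eigenspace, corrects this.\<close>

lemma error_group_restrict:
  assumes G: "error_group D G" "g \<in> G" "h \<in> G" and anti: "chi h g = -1" and d: "0 < d"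
    and V: "V \<in> carrier_mat D d" "mat_adjoint V * V = 1\<^sub>m d" "e \<noteq> 0" "g * V = e \<cdot>\<^sub>m V"
    and comm: "\<And>A. A \<in> G \<Longrightarrow> chi A g = 1 \<Longrightarrow> A * (V * mat_adjoint V) = (V * mat_adjoint V) * A"
  shows "error_group d ((\<lambda>A. mat_adjoint V * (A * V)) ` {A \<in> G. chi A g = 1})"
proof -
  note D = error_groupD[OF G(1)]
  note dG [simp] = D(4,5)
  have dV [simp]: "dim_row V = D" "dim_col V = d" using V by auto
  let ?r = "\<lambda>A. mat_adjoint V * (A * V)"
  let ?C = "{A \<in> G. chi A g = 1}"
  have rm: "?r A * ?r B = ?r (A * B)" if "A \<in> ?C" "B \<in> G" for A B
  proof -
    from that have [simp]: "dim_row A = D" "dim_col A = D" "dim_row B = D" "dim_col B = D" by auto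
    have "?r A * ?r B = mat_adjoint V * (A * (V * mat_adjoint V) * (B * V))"
      by (simp add: mat_mult_assoc)
    also have "A * (V * mat_adjoint V) = (V * mat_adjoint V) * A" using comm that by blast
    also have "mat_adjoint V * (V * mat_adjoint V * A * (B * V)) = (mat_adjoint V * V) * ?r (A * B)"
      by (simp add: mat_mult_assoc)
    finally show ?thesis unfolding V(2) by (simp add: mat_mult_assoc)
  qed
  have C1: "1\<^sub>m D \<in> ?C" using D(3) dG[OF G(2)] by (simp add: chi_def)
  have r1: "?r (1\<^sub>m D) = 1\<^sub>m d" using V(2) by simp
  have Cm: "A * B \<in> ?C" if "A \<in> ?C" "B \<in> ?C" for A B
    using that D(7) chi_mult_left[OF G(1) _ _ G(2)] by auto
  have Ca: "mat_adjoint A \<in> ?C" if "A \<in> ?C" for A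
    using that D(9) chi_adjoint[OF G(1) _ G(2)] by auto
  have ra: "mat_adjoint (?r A) = ?r (mat_adjoint A)" if "A \<in> ?C" for A
    using that by (simp add: adjoint_mult mat_mult_assoc)
  have rs: "?r (c \<cdot>\<^sub>m A) = c \<cdot>\<^sub>m ?r A" if "A \<in> G" for A c
    using that by (simp add: mat_algebra)
  have unit: "mat_adjoint (?r A) * ?r A = 1\<^sub>m d" if "A \<in> ?C" for A
    using ra[OF that] rm[OF Ca[OF that], of A] that D(11) r1 by auto
  have centre: "\<exists>c. ?r A = c \<cdot>\<^sub>m 1\<^sub>m d" if A: "A \<in> ?C" and cm: "\<And>B. B \<in> ?C \<Longrightarrow> ?r A * ?r B = ?r B * ?r A" for A
  proof -
    have AG: "A \<in> G" using A by simp
    \<comment> \<open>If \<open>A\<close> and \<open>B\<close> anticommuted, the compression of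
      \<open>A * B\<close> would equal its own negative, impossible for a unitary in positive
      dimension.\<close>
    have comC: "chi A B = 1" if B: "B \<in> ?C" for B
    proof (rule ccontr)
      assume "chi A B \<noteq> 1"
      then have "A * B = (-1) \<cdot>\<^sub>m (B * A)" using chi_eq[OF G(1) AG, of B] B chi_pm[of A B] by auto
      then have "?r A * ?r B = (-1) \<cdot>\<^sub>m (?r B * ?r A)"
        using rm[OF A, of B] rm[OF B AG] rs[of "B * A" "-1"] D(7) AG B by auto
      then have "?r A * ?r B = (-1) \<cdot>\<^sub>m (?r A * ?r B)" using cm[OF B] by simp
      then have z: "?r (A * B) = (-1) \<cdot>\<^sub>m ?r (A * B)" using rm[OF A, of B] B by simp
      have AB: "A * B \<in> ?C" using Cm A B by blast
      have "1\<^sub>m d = mat_adjoint (?r (A * B)) * ?r (A * B)" using unit[OF AB] by simp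
      also have "\<dots> = mat_adjoint (?r (A * B)) * ((-1) \<cdot>\<^sub>m ?r (A * B))" using z by simp
      also have "\<dots> = (-1) \<cdot>\<^sub>m (mat_adjoint (?r (A * B)) * ?r (A * B))"
        by (rule mult_smult) simp
      also have "\<dots> = (-1) \<cdot>\<^sub>m 1\<^sub>m d" using unit[OF AB] by simp
      finally have "(1\<^sub>m d :: complex mat) $$ (0, 0) = ((-1) \<cdot>\<^sub>m 1\<^sub>m d) $$ (0, 0)" by simp
      then show False using d by simp
    qed
    have scalar: "\<exists>c. M = c \<cdot>\<^sub>m 1\<^sub>m D" if M: "M \<in> G" "chi M h = 1" "\<And>B. B \<in> ?C \<Longrightarrow> chi M B = 1" for M
    proof -
      have all: "chi M B = 1" if B: "B \<in> G" for B
      proof (cases "chi B g = 1")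
        case True
        then show ?thesis using M(3) B by blast
      next
        \<comment> \<open>The centralizer of \<open>g\<close> together with \<open>h\<close>
          generates \<open>G\<close>: if \<open>B\<close> anticommutes with \<open>g\<close>, then
          \<open>h * B\<close> commutes with it.\<close>
        case False
        then have "h * B \<in> ?C"
          using chi_mult_left[OF G(1,3) B G(2)] anti chi_pm[of B g] D(7)[OF G(3) B] by auto
        then show ?thesis using M(2) M(3)[of "h * B"] chi_mult[OF G(1) M(1) G(3) B] by simp
      qed
      have "M * B = B * M" if "B \<in> G" for B
        using all[OF that] by (simp add: chi_def split: if_splits)
      then show ?thesis by (rule D(13)[OF M(1)])
    qed
    have r_scalar: "?r (c \<cdot>\<^sub>m 1\<^sub>m D) = c \<cdot>\<^sub>m 1\<^sub>m d" for c
      using rs[OF D(3)] r1 by simp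
    show ?thesis
    proof (cases "chi A h = 1")
      case True
      then show ?thesis using scalar[OF AG True comC] r_scalar by blast
    next
      case False
      \<comment> \<open>Both \<open>g\<close> and \<open>A\<close> anticommute with
        \<open>h\<close>, so their product commutes with it and is a scalar.\<close>
      have gA: "g * A \<in> G" using D(7)[OF G(2) AG] .
      have "chi (g * A) h = 1"
        using chi_mult_left[OF G(1,2) AG G(3)] anti False chi_pm[of A h] chi_commute[of g h] by auto
      moreover have "chi (g * A) B = 1" if "B \<in> ?C" for B
        using chi_mult_left[OF G(1,2) AG, of B] comC[OF that] that chi_commute[of g B] by auto
      ultimately obtain c where c: "g * A = c \<cdot>\<^sub>m 1\<^sub>m D" using scalar[OF gA] by blast
      have "A * g = g * A" using A by (simp add: chi_def split: if_splits)
      have "e \<cdot>\<^sub>m ?r A = mat_adjoint V * (A * (e \<cdot>\<^sub>m V))" using dG[OF AG] by (simp add: mat_algebra)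
      also have "\<dots> = mat_adjoint V * ((A * g) * V)"
        unfolding V(4)[symmetric] using dG[OF AG] dG[OF G(2)] by (simp add: mat_mult_assoc)
      also have "\<dots> = c \<cdot>\<^sub>m 1\<^sub>m d" unfolding \<open>A * g = g * A\<close> c using r_scalar by simp
      finally have "inverse e \<cdot>\<^sub>m (e \<cdot>\<^sub>m ?r A) = inverse e \<cdot>\<^sub>m (c \<cdot>\<^sub>m 1\<^sub>m d)" by simp
      then have "?r A = (inverse e * c) \<cdot>\<^sub>m 1\<^sub>m d" using V(3) by (simp add: smult_smult smult_one)
      then show ?thesis by blast
    qed
  qed
  have prod: "A' * B' \<in> ?r ` ?C \<and> (A' * B' = B' * A' \<or> A' * B' = - (B' * A'))"
    if "A' \<in> ?r ` ?C" "B' \<in> ?r ` ?C" for A' B'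
  proof -
    from that obtain A B where A: "A' = ?r A" "A \<in> ?C" and B: "B' = ?r B" "B \<in> ?C" by blast
    have AB: "A \<in> G" "B \<in> G" using A B by auto
    have "A' * B' \<in> ?r ` ?C" unfolding A(1) B(1) rm[OF A(2) AB(2)] using Cm[OF A(2) B(2)] by blast
    moreover have "A' * B' = B' * A' \<or> A' * B' = - (B' * A')"
      unfolding A(1) B(1) rm[OF A(2) AB(2)] rm[OF B(2) AB(1)] uminus_smult
        rs[OF D(7)[OF AB(2,1)], symmetric]
      using D(8)[OF AB] unfolding uminus_smult by (elim disjE) simp_all
    ultimately show ?thesis by blast
  qed
  have adj: "mat_adjoint A' \<in> ?r ` ?C \<and> (mat_adjoint A' = A' \<or> mat_adjoint A' = - A') \<and> mat_adjoint A' * A' = 1\<^sub>m d"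
    if "A' \<in> ?r ` ?C" for A'
  proof -
    from that obtain A where A: "A' = ?r A" "A \<in> ?C" by blast
    have AG: "A \<in> G" using A by simp
    have "mat_adjoint A' \<in> ?r ` ?C" unfolding A(1) ra[OF A(2)] using Ca[OF A(2)] by blast
    moreover have "mat_adjoint A' = A' \<or> mat_adjoint A' = - A'"
      unfolding A(1) ra[OF A(2)] uminus_smult rs[OF AG, symmetric]
      using D(10)[OF AG] unfolding uminus_smult by (elim disjE) simp_all
    moreover have "mat_adjoint A' * A' = 1\<^sub>m d" unfolding A(1) by (rule unit[OF A(2)])
    ultimately show ?thesis by blast
  qed
  have cen: "\<exists>c. A' = c \<cdot>\<^sub>m 1\<^sub>m d" if "A' \<in> ?r ` ?C" "\<forall>B'\<in>?r ` ?C. A' * B' = B' * A'" for A'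
  proof -
    from that obtain A where A: "A' = ?r A" "A \<in> ?C" by blast
    show ?thesis unfolding A(1)
      by (rule centre[OF A(2)]) (rule bspec[OF that(2)[unfolded A(1)] imageI])
  qed
  have "finite (?r ` ?C)" using D(2) by simp
  moreover have "?r ` ?C \<subseteq> carrier_mat d d" by (auto intro!: carrier_matI)
  moreover have "1\<^sub>m d \<in> ?r ` ?C" by (rule image_eqI[where x = "1\<^sub>m D"]) (use r1 C1 in simp_all)
  ultimately show ?thesis
    unfolding error_group_def using d prod adj cen by (intro conjI ballI impI) simp_all
qed

section \<open>States as lists of operators\<close>

text \<open>The operator \<open>X\<close> from Alice's to Bob's space stands for the vector with amplitude \<open>X $$ (y, x)\<close>
  at \<open>|x\<rangle>|y\<rangle>\<close>. In this picture \<open>A\<close> on Alice's side and \<open>B\<close> on Bob's side turn \<open>X\<close> into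
  \<open>B X A\<^sup>T\<close>, and the identity is a multiple of the EPR state.\<close>

definition dens :: "nat \<Rightarrow> nat \<Rightarrow> complex mat list \<Rightarrow> complex mat" where
  "dens a b Xs = mat (a * b) (a * b)
     (\<lambda>(i, j). \<Sum>X\<leftarrow>Xs. X $$ (i mod b, i div b) * cnj (X $$ (j mod b, j div b)))"

lemma dens_index:
  "i < a * b \<Longrightarrow> j < a * b \<Longrightarrow>
    dens a b Xs $$ (i, j) = (\<Sum>X\<leftarrow>Xs. X $$ (i mod b, i div b) * cnj (X $$ (j mod b, j div b)))"
  "dim_row (dens a b Xs) = a * b" "dim_col (dens a b Xs) = a * b"
  by (auto simp: dens_def)

lemma sum_div_mod:
  fixes f :: "nat \<Rightarrow> nat \<Rightarrow> 'a :: comm_monoid_add"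
  shows "(\<Sum>k<a * b. f (k div b) (k mod b)) = (\<Sum>x<a. \<Sum>y<b. f x y)"
proof -
  have "(\<Sum>k<a * b. f (k div b) (k mod b)) = (\<Sum>(x, y)\<in>{..<a} \<times> {..<b}. f x y)"
  proof (rule sum.reindex_bij_witness[where i = "\<lambda>(x, y). x * b + y" and j = "\<lambda>k. (k div b, k mod b)"])
    fix k assume "k \<in> {..<a * b}"
    then have k: "k < a * b" and b: "0 < b" by (auto intro: Nat.gr0I)
    show "(k div b, k mod b) \<in> {..<a} \<times> {..<b}"
      using b k by (auto simp: less_mult_imp_div_less)
  next
    fix z assume "z \<in> {..<a} \<times> {..<b}"
    then obtain x y where z: "z = (x, y)" "x < a" "y < b" by auto
    have "x * b + y < Suc x * b" using z by simp
    also have "\<dots> \<le> a * b" using z by (intro mult_le_mono1) simp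
    finally show "(case z of (x, y) \<Rightarrow> x * b + y) \<in> {..<a * b}" using z by simp
  qed auto
  then show ?thesis by (simp add: sum.cartesian_product)
qed

lemma tensor_mat_vec:
  assumes [simp]: "dim_row A = a'" "dim_col A = a" "dim_row B = b'" "dim_col B = b" "dim_row X = b" "dim_col X = a"
    and i: "i < a' * b'"
  shows "(\<Sum>k<a * b. tensor_mat A B $$ (i, k) * X $$ (k mod b, k div b)) =
    (B * X * transpose_mat A) $$ (i mod b', i div b')"
proof -
  have b': "0 < b'" using i by (auto intro: Nat.gr0I)
  have i': "i div b' < a'" "i mod b' < b'" using i b' by (auto simp: less_mult_imp_div_less)
  have "(\<Sum>k<a * b. tensor_mat A B $$ (i, k) * X $$ (k mod b, k div b)) =
     (\<Sum>k<a * b. A $$ (i div b', k div b) * B $$ (i mod b', k mod b) * X $$ (k mod b, k div b))"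
    using i by (intro sum.cong) (auto simp: tensor_mat_def)
  also have "\<dots> = (\<Sum>x<a. \<Sum>y<b. A $$ (i div b', x) * B $$ (i mod b', y) * X $$ (y, x))"
    by (rule sum_div_mod)
  also have "\<dots> = (\<Sum>x<a. (\<Sum>y<b. B $$ (i mod b', y) * X $$ (y, x)) * A $$ (i div b', x))"
    by (simp add: sum_distrib_left sum_distrib_right mult_ac)
  also have "\<dots> = (B * X * transpose_mat A) $$ (i mod b', i div b')"
    using i' by (simp add: index_mult_sum del: index_mult_mat(1))
  finally show ?thesis .
qed

lemma conj_tensor_dens:
  assumes A: "A \<in> carrier_mat a' a" and B: "B \<in> carrier_mat b' b" and Xs: "set Xs \<subseteq> carrier_mat b a"
    and ij: "i < a' * b'" "j < a' * b'"
  shows "(tensor_mat A B * dens a b Xs * mat_adjoint (tensor_mat A B)) $$ (i, j) =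
     (\<Sum>X\<leftarrow>Xs. (B * X * transpose_mat A) $$ (i mod b', i div b') *
        cnj ((B * X * transpose_mat A) $$ (j mod b', j div b')))"
proof -
  define K where "K = tensor_mat A B"
  have dK [simp]: "dim_row K = a' * b'" "dim_col K = a * b" using A B by (auto simp: K_def tensor_mat_def)
  have dR [simp]: "dim_row (dens a b Xs) = a * b" "dim_col (dens a b Xs) = a * b" by (auto simp: dens_def)
  define w where "w m k = (Xs ! m) $$ (k mod b, k div b)" for m k
  have R: "dens a b Xs $$ (k, l) = (\<Sum>m<length Xs. w m k * cnj (w m l))" if "k < a * b" "l < a * b" for k l
    using that by (simp add: dens_def w_def sum_list_sum_nth atLeast0LessThan)
  have W: "(\<Sum>k<a * b. K $$ (i, k) * w m k) = (B * (Xs ! m) * transpose_mat A) $$ (i mod b', i div b')"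
    if "i < a' * b'" "m < length Xs" for i m
  proof -
    have "Xs ! m \<in> carrier_mat b a" using Xs nth_mem[OF that(2)] by blast
    then show ?thesis
      unfolding K_def w_def by (intro tensor_mat_vec) (use A B that in auto)
  qed
  have "(K * dens a b Xs * mat_adjoint K) $$ (i, j) =
      (\<Sum>l<a * b. (\<Sum>k<a * b. K $$ (i, k) * (\<Sum>m<length Xs. w m k * cnj (w m l))) * cnj (K $$ (j, l)))"
    using ij by (simp add: index_mult_sum R del: index_mult_mat(1))
  also have "\<dots> = (\<Sum>l<a * b. \<Sum>k<a * b. \<Sum>m<length Xs. (K $$ (i, k) * w m k) * cnj (K $$ (j, l) * w m l))"
    by (simp add: sum_distrib_left sum_distrib_right mult_ac)
  also have "\<dots> = (\<Sum>l<a * b. \<Sum>m<length Xs. \<Sum>k<a * b. (K $$ (i, k) * w m k) * cnj (K $$ (j, l) * w m l))"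
    by (intro sum.cong refl sum.swap)
  also have "\<dots> = (\<Sum>m<length Xs. \<Sum>l<a * b. \<Sum>k<a * b. (K $$ (i, k) * w m k) * cnj (K $$ (j, l) * w m l))"
    by (rule sum.swap)
  also have "\<dots> = (\<Sum>m<length Xs. (\<Sum>k<a * b. K $$ (i, k) * w m k) * cnj (\<Sum>l<a * b. K $$ (j, l) * w m l))"
    unfolding cnj_sum sum_product by (intro sum.cong refl sum.swap)
  also have "\<dots> = (\<Sum>m<length Xs. (B * (Xs ! m) * transpose_mat A) $$ (i mod b', i div b') *
        cnj ((B * (Xs ! m) * transpose_mat A) $$ (j mod b', j div b')))"
    by (intro sum.cong refl) (simp only: W ij lessThan_iff)
  finally show ?thesis unfolding K_def by (simp add: sum_list_sum_nth atLeast0LessThan)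
qed

lemma apply_kraus_tensor:
  assumes "A \<in> carrier_mat a' a" "B \<in> carrier_mat b' b" "set Xs \<subseteq> carrier_mat b a"
  shows "apply_kraus (a' * b') [tensor_mat A B] (dens a b Xs) =
    dens a' b' (map (\<lambda>X. B * X * transpose_mat A) Xs)"
  unfolding apply_kraus_def msum_def
  by (intro eq_matI) (simp_all add: conj_tensor_dens[OF assms] dens_index comp_def del: index_mult_mat(1))

text \<open>The form needed for the channel: several Kraus operators act on one pure state, and each
  contributes an entry of the resulting list.\<close>

lemma apply_kraus_Bob:
  assumes "set Bs \<subseteq> carrier_mat b b" "X \<in> carrier_mat b a"
  shows "apply_kraus (a * b) (map (tensor_mat (1\<^sub>m a)) Bs) (dens a b [X]) = dens a b (map (\<lambda>B. B * X) Bs)"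
proof (intro eq_matI)
  fix i j assume "i < dim_row (dens a b (map (\<lambda>B. B * X) Bs))" "j < dim_col (dens a b (map (\<lambda>B. B * X) Bs))"
  then have ij: "i < a * b" "j < a * b" by (auto simp: dens_def)
  have "(tensor_mat (1\<^sub>m a) B * dens a b [X] * mat_adjoint (tensor_mat (1\<^sub>m a) B)) $$ (i, j) =
     (B * X) $$ (i mod b, i div b) * cnj ((B * X) $$ (j mod b, j div b))" if "B \<in> set Bs" for B
  proof -
    have "B * X * transpose_mat (1\<^sub>m a) = B * X" using assms that by simp
    then show ?thesis
      using conj_tensor_dens[of "1\<^sub>m a" a a B b b "[X]" i j] assms that ij by auto
  qed
  then have eq: "map ((\<lambda>K. (K * dens a b [X] * mat_adjoint K) $$ (i, j)) \<circ> tensor_mat (1\<^sub>m a)) Bs =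
     map (\<lambda>B. (B * X) $$ (i mod b, i div b) * cnj ((B * X) $$ (j mod b, j div b))) Bs"
    by simp
  show "apply_kraus (a * b) (map (tensor_mat (1\<^sub>m a)) Bs) (dens a b [X]) $$ (i, j) =
      dens a b (map (\<lambda>B. B * X) Bs) $$ (i, j)"
    using ij arg_cong[OF eq, of sum_list] by (simp add: apply_kraus_def msum_def dens_index(1)[of i a b j "map _ _"] comp_def
        del: index_mult_mat(1) map_eq_conv)
qed (auto simp: apply_kraus_def msum_def dens_def)

text \<open>The complex linear span; \<open>d\<close> fixes the size of the zero matrix, so that the
  span of no candidates makes sense. The inductive form lets linear maps be traced one summand at a
  time.\<close>

inductive_set mspan :: "nat \<Rightarrow> complex mat set \<Rightarrow> complex mat set" for d S where
  zero: "0\<^sub>m d d \<in> mspan d S"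
| add: "X \<in> mspan d S \<Longrightarrow> A \<in> S \<Longrightarrow> X + c \<cdot>\<^sub>m A \<in> mspan d S"

lemma mspan_carrier: "S \<subseteq> carrier_mat d d \<Longrightarrow> X \<in> mspan d S \<Longrightarrow> X \<in> carrier_mat d d"
  by (rotate_tac, induction rule: mspan.induct) auto

lemma mspan_sum:
  assumes "S \<subseteq> carrier_mat d d" "finite K" "\<And>k. k \<in> K \<Longrightarrow> A k \<in> S"
  shows "mat d d (\<lambda>ij. \<Sum>k\<in>K. c k * A k $$ ij) \<in> mspan d S"
  using assms(2,3)
proof (induction K rule: finite_induct)
  case empty
  have "mat d d (\<lambda>ij. \<Sum>k\<in>{}. c k * A k $$ ij) = 0\<^sub>m d d" by (intro eq_matI) auto
  then show ?case by (simp only: mspan.zero)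
next
  case (insert k K)
  have "A k \<in> carrier_mat d d" using insert.prems assms(1) by blast
  then have "mat d d (\<lambda>ij. \<Sum>k\<in>insert k K. c k * A k $$ ij) =
      mat d d (\<lambda>ij. \<Sum>k\<in>K. c k * A k $$ ij) + c k \<cdot>\<^sub>m A k"
    using insert.hyps by (intro eq_matI) auto
  then show ?case using insert by (simp only: mspan.add insertI1 insertI2)
qed

text \<open>Scalars are absorbed by the span, so a candidate set may be thinned out to pairwise
  non-proportional members.\<close>

lemma mspan_subset:
  assumes "X \<in> mspan d S" "\<And>A. A \<in> S \<Longrightarrow> \<exists>B\<in>T. \<exists>c. A = c \<cdot>\<^sub>m B"
  shows "X \<in> mspan d T"
  using assms(1)
proof induction
  case (add X A c)
  obtain e B where "B \<in> T" "A = e \<cdot>\<^sub>m B" using assms(2)[OF add.hyps(2)] by blast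
  then show ?case using mspan.add[OF add.IH, of B "c * e"] by (simp add: smult_smult)
qed (rule mspan.zero)

lemma mspan_singleton:
  assumes "X \<in> mspan d S" "S \<subseteq> {A}" "A \<in> carrier_mat d d"
  shows "\<exists>c. X = c \<cdot>\<^sub>m A"
  using assms(1)
proof induction
  case zero
  have "0\<^sub>m d d = 0 \<cdot>\<^sub>m A" using assms(3) by (intro eq_matI) auto
  then show ?case by (rule exI)
next
  case (add X B c)
  from add.IH obtain e where X: "X = e \<cdot>\<^sub>m A" by (rule exE)
  have B: "B = A" using add.hyps(2) assms(2) by blast
  have "X + c \<cdot>\<^sub>m B = (e + c) \<cdot>\<^sub>m A"
    unfolding X B by (intro eq_matI) (simp_all add: distrib_right)
  then show ?case by (rule exI)
qed

text \<open>\<open>R\<close> is only a preorder: the relation A = c B allows c = 0 and need not be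
  symmetric. Dominated elements are therefore removed one at a time instead of choosing class
  representatives.\<close>

lemma exists_irredundant_subset:
  assumes "finite S" and refl: "\<And>x. R x x" and trans: "\<And>x y z. R x y \<Longrightarrow> R y z \<Longrightarrow> R x z"
  shows "\<exists>T\<subseteq>S. (\<forall>x\<in>S. \<exists>y\<in>T. R x y) \<and> (\<forall>x\<in>T. \<forall>y\<in>T. x \<noteq> y \<longrightarrow> \<not> R x y)"
  using assms(1)
proof (induction "card S" arbitrary: S rule: less_induct)
  case less
  show ?case
  proof (cases "\<exists>x\<in>S. \<exists>y\<in>S. x \<noteq> y \<and> R x y")
    case True
    then obtain x y where xy: "x \<in> S" "y \<in> S" "x \<noteq> y" "R x y" by blast
    have "card (S - {x}) < card S" "finite (S - {x})"
      using card_Diff1_less[OF less.prems xy(1)] less.prems by simp_all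
    from less.hyps[OF this] obtain T where T: "T \<subseteq> S - {x}" "\<forall>x\<in>S - {x}. \<exists>y\<in>T. R x y"
      "\<forall>x\<in>T. \<forall>y\<in>T. x \<noteq> y \<longrightarrow> \<not> R x y"
      by blast
    obtain z where "z \<in> T" "R y z" using T(2) xy by blast
    then have "\<exists>z\<in>T. R w z" if "w \<in> S" for w
      using that T(2) trans[OF xy(4)] by (cases "w = x") blast+
    then show ?thesis using T(1,3) by (intro exI[of _ T]) blast
  next
    case False
    then show ?thesis using refl by (intro exI[of _ S]) blast
  qed
qed

lemma exists_independent_subset:
  fixes S :: "complex mat set"
  assumes "finite S"
  shows "\<exists>T\<subseteq>S. (\<forall>A\<in>S. \<exists>B\<in>T. \<exists>c. A = c \<cdot>\<^sub>m B) \<and> (\<forall>A\<in>T. \<forall>B\<in>T. A \<noteq> B \<longrightarrow> \<not> (\<exists>c. A = c \<cdot>\<^sub>m B))"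
  using assms
proof (rule exists_irredundant_subset)
  show "\<exists>c. A = c \<cdot>\<^sub>m A" for A :: "complex mat"
    by (rule exI[of _ 1]) (simp add: smult_one)
  show "\<exists>c. A = c \<cdot>\<^sub>m C" if "\<exists>c. A = c \<cdot>\<^sub>m B" "\<exists>c. B = c \<cdot>\<^sub>m C" for A B C :: "complex mat"
    using that by (elim exE) (simp only: smult_smult, rule exI, rule refl)
qed

section \<open>The purification protocol\<close>

lemma superoperator_pair:
  assumes "K \<in> carrier_mat d' d" "L \<in> carrier_mat d' d" "mat_adjoint K * K + mat_adjoint L * L = 1\<^sub>m d"
  shows "superoperator d d' [K, L]"
proof -
  have "msum d (map (\<lambda>K. mat_adjoint K * K) [K, L]) = mat_adjoint K * K + mat_adjoint L * L"
    unfolding msum_def using assms(1,2) by (intro eq_matI) auto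
  then show ?thesis unfolding superoperator_def using assms by simp
qed

lemma adjoint_transpose: "mat_adjoint (transpose_mat A) * transpose_mat A = transpose_mat (A * mat_adjoint A)"
  for A :: "complex mat"
  by (intro eq_matI) (auto simp: index_mult_sum mult.commute simp del: index_mult_mat(1))

text \<open>The commutation signs are multiplicative in \<open>B\<close> only for \<open>A\<close>
  in \<open>G\<close>; the value 1 elsewhere makes closure under products hold for functions on all
  matrices.\<close>

lemma sign_group_chi:
  assumes G: "error_group d G"
  shows "sign_group ((\<lambda>B A. if A \<in> G then chi A B else 1) ` G)"
proof -
  note D = error_groupD[OF G]
  let ?f = "\<lambda>B A. if A \<in> G then chi A B else 1"
  have "?f (1\<^sub>m d) \<in> ?f ` G" by (rule imageI[OF D(3)])
  moreover have "?f (1\<^sub>m d) = (\<lambda>_. 1)" by (rule ext) (simp add: chi_def D(4,5))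
  ultimately have one: "(\<lambda>_. 1) \<in> ?f ` G" by simp
  have mult: "(\<lambda>A. ?f B A * ?f C A) \<in> ?f ` G" if "B \<in> G" "C \<in> G" for B C
  proof -
    have "?f (B * C) \<in> ?f ` G" by (rule imageI[OF D(7)[OF that]])
    moreover have "?f (B * C) = (\<lambda>A. ?f B A * ?f C A)"
      by (rule ext) (simp add: chi_mult[OF G _ that])
    ultimately show ?thesis by simp
  qed
  show ?thesis
    unfolding sign_group_def
  proof (intro conjI ballI allI one finite_imageI D(2))
    fix f A assume "f \<in> ?f ` G"
    then show "f A = 1 \<or> f A = -1" using chi_pm by (elim imageE) simp
  next
    fix f g assume "f \<in> ?f ` G" "g \<in> ?f ` G"
    then show "(\<lambda>A. f A * g A) \<in> ?f ` G" by (elim imageE) (simp only: mult)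
  qed
qed

text \<open>The entries add incoherently, so the factor is the sum of the squared moduli of the
  scalars.\<close>

lemma dens_scalars:
  assumes "\<And>X. X \<in> set Xs \<Longrightarrow> \<exists>c. X = c \<cdot>\<^sub>m 1\<^sub>m d"
  shows "\<exists>c. dens d d Xs = c \<cdot>\<^sub>m dens d d [1\<^sub>m d]"
  using assms
proof (induction Xs)
  case Nil
  show ?case by (rule exI[of _ 0], intro eq_matI) (auto simp: dens_def)
next
  case (Cons X Xs)
  have "\<exists>c. dens d d Xs = c \<cdot>\<^sub>m dens d d [1\<^sub>m d]" by (rule Cons.IH) (simp add: Cons.prems)
  then obtain c where c: "dens d d Xs = c \<cdot>\<^sub>m dens d d [1\<^sub>m d]" by (rule exE)
  obtain e where e: "X = e \<cdot>\<^sub>m 1\<^sub>m d" using Cons.prems[of X] by auto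
  have "dens d d (X # Xs) = (c + e * cnj e) \<cdot>\<^sub>m dens d d [1\<^sub>m d]"
  proof (intro eq_matI)
    fix i j assume "i < dim_row ((c + e * cnj e) \<cdot>\<^sub>m dens d d [1\<^sub>m d])" "j < dim_col ((c + e * cnj e) \<cdot>\<^sub>m dens d d [1\<^sub>m d])"
    then have ij: "i < d * d" "j < d * d" by (auto simp: dens_def)
    then have d: "0 < d" by (auto intro: Nat.gr0I)
    have "dens d d (X # Xs) $$ (i, j) = X $$ (i mod d, i div d) * cnj (X $$ (j mod d, j div d)) + dens d d Xs $$ (i, j)"
      using ij by (simp add: dens_def)
    then show "dens d d (X # Xs) $$ (i, j) = ((c + e * cnj e) \<cdot>\<^sub>m dens d d [1\<^sub>m d]) $$ (i, j)"
      unfolding c e using ij d by (simp add: dens_def algebra_simps less_mult_imp_div_less)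
  qed (auto simp: dens_def)
  then show ?case by (rule exI)
qed

text \<open>The invariant of the recursion. Lists over the span cover mixtures and superpositions of
  candidates alike; the output size \<open>m\<close> may differ between branches, but none loses
  more than \<open>s\<close> pairs. The scalar \<open>c\<close> may be 0, for branches of
  probability zero.\<close>

definition resolves :: "nat \<Rightarrow> complex mat set \<Rightarrow> nat \<Rightarrow> protocol \<Rightarrow> bool" where
  "resolves n S s P \<longleftrightarrow> well_formed P (2 ^ n) (2 ^ n) \<and>
     (\<forall>Xs. set Xs \<subseteq> mspan (2 ^ n) S \<longrightarrow>
        (\<forall>(m, \<sigma>) \<in> results P (2 ^ n) (2 ^ n) (dens (2 ^ n) (2 ^ n) Xs).
           n \<le> m + s \<and> (\<exists>c. \<sigma> = c \<cdot>\<^sub>m dens (2 ^ m) (2 ^ m) [1\<^sub>m (2 ^ m)])))"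

text \<open>Bob undoes the one remaining error by a unitary. With \<open>S\<close> empty any
  \<open>A\<close> will do, as the state is then zero.\<close>

lemma resolves_singleton:
  assumes G: "error_group (2 ^ n) G" "A \<in> G" "S \<subseteq> {A}"
  shows "\<exists>P. resolves n S s P"
proof -
  note D = error_groupD[OF G(1)]
  note [simp] = D(4,5)[OF G(2)]
  let ?d = "2 ^ n :: nat"
  let ?P = "Local Bob ?d [[mat_adjoint A]] (\<lambda>_. Output n)"
  have "msum ?d [mat_adjoint (mat_adjoint A) * mat_adjoint A] = 1\<^sub>m ?d"
    using D(12)[OF G(2)] by (intro eq_matI) (auto simp: msum_def)
  then have wf: "well_formed ?P ?d ?d"
    using D(6)[OF D(9)[OF G(2)]] by (simp add: superoperator_def)
  have "\<exists>c. apply_kraus (?d * ?d) [tensor_mat (1\<^sub>m ?d) (mat_adjoint A)] (dens ?d ?d Xs) = c \<cdot>\<^sub>m dens ?d ?d [1\<^sub>m ?d]"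
    if Xs: "set Xs \<subseteq> mspan ?d S" for Xs
  proof -
    have X: "\<exists>c. X = c \<cdot>\<^sub>m A" if "X \<in> set Xs" for X
      using mspan_singleton[of X ?d S A] that Xs G(3) D(6)[OF G(2)] by blast
    then have Xc: "set Xs \<subseteq> carrier_mat ?d ?d" using D(6)[OF G(2)] by fastforce
    have eq: "apply_kraus (?d * ?d) [tensor_mat (1\<^sub>m ?d) (mat_adjoint A)] (dens ?d ?d Xs) =
      dens ?d ?d (map (\<lambda>X. mat_adjoint A * X * transpose_mat (1\<^sub>m ?d)) Xs)"
      by (rule apply_kraus_tensor) (use Xc D(6)[OF D(9)[OF G(2)]] in auto)
    show ?thesis
      unfolding eq
    proof (rule dens_scalars)
      fix Y assume "Y \<in> set (map (\<lambda>X. mat_adjoint A * X * transpose_mat (1\<^sub>m ?d)) Xs)"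
      then obtain X where "X \<in> set Xs" "Y = mat_adjoint A * X * transpose_mat (1\<^sub>m ?d)" by auto
      moreover obtain c where "X = c \<cdot>\<^sub>m A" using X calculation(1) by blast
      ultimately have "Y = c \<cdot>\<^sub>m 1\<^sub>m ?d" using D(11)[OF G(2)] by (simp add: mat_algebra)
      then show "\<exists>c. Y = c \<cdot>\<^sub>m 1\<^sub>m ?d" by blast
    qed
  qed
  then have "resolves n S s ?P" unfolding resolves_def using wf by simp
  then show ?thesis by blast
qed

lemma resolves_mono:
  assumes "resolves n T s P" "s \<le> s'" "\<And>A. A \<in> S \<Longrightarrow> \<exists>B\<in>T. \<exists>c. A = c \<cdot>\<^sub>m B"
  shows "resolves n S s' P"
  unfolding resolves_def
proof (intro conjI allI impI ballI)
  show "well_formed P (2 ^ n) (2 ^ n)" using assms(1) by (simp add: resolves_def)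
  fix Xs r assume "set Xs \<subseteq> mspan (2 ^ n) S" and r: "r \<in> results P (2 ^ n) (2 ^ n) (dens (2 ^ n) (2 ^ n) Xs)"
  then have "set Xs \<subseteq> mspan (2 ^ n) T" using mspan_subset assms(3) by blast
  then show "case r of (m, \<sigma>) \<Rightarrow> n \<le> m + s' \<and> (\<exists>c. \<sigma> = c \<cdot>\<^sub>m dens (2 ^ m) (2 ^ m) [1\<^sub>m (2 ^ m)])"
    using assms(1,2) r unfolding resolves_def by fastforce
qed

text \<open>Alice and Bob measure \<open>g\<close>, each mapping the eigenspace found isometrically
  onto dimension \<open>d\<close>; this costs one pair. Outcomes \<open>a\<close>, \<open>b\<close>
  turn X into \<open>mat_adjoint (W b) * X * W a\<close>. A candidate survives only if its
  commutation sign with \<open>g\<close> matches the comparison of the outcomes, so the survivors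
  come from one of the two halves of \<open>T\<close>.\<close>

lemma resolves_step:
  fixes n :: nat
  defines "d \<equiv> 2 ^ n :: nat"
  assumes G: "error_group (2 * d) G" "g \<in> G" "h \<in> G" "T \<subseteq> G" and anti: "chi h g = -1"
    and T: "finite T" "card {A \<in> T. chi A g = 1} \<le> N" "card {A \<in> T. chi A g = -1} \<le> N"
    and IH: "\<And>G S. error_group d G \<Longrightarrow> S \<subseteq> G \<Longrightarrow> card S \<le> N \<Longrightarrow> \<exists>P. resolves n S s P"
  shows "\<exists>P. resolves (Suc n) T (Suc s) P"
proof -
  let ?D = "2 * d"
  note D = error_groupD[OF G(1)]
  have d: "0 < d" by (simp add: d_def)
  obtain V e where V: "V \<in> carrier_mat ?D d" "mat_adjoint V * V = 1\<^sub>m d" "e \<noteq> 0" "g * V = e \<cdot>\<^sub>m V"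
    and Vg: "mat_adjoint V * g = e \<cdot>\<^sub>m mat_adjoint V"
    and compl: "V * mat_adjoint V + h * V * mat_adjoint (h * V) = 1\<^sub>m ?D"
    and comm: "\<And>A. A \<in> G \<Longrightarrow> chi A g = 1 \<Longrightarrow> A * (V * mat_adjoint V) = (V * mat_adjoint V) * A"
    using eigenspace_isometry[OF G(1,2,3) anti] by metis
  note G' = error_group_restrict[OF G(1,2,3) anti d V comm]
  have dV [simp]: "dim_row V = ?D" "dim_col V = d" using V by auto
  have dg [simp]: "dim_row g = ?D" "dim_col g = ?D" using D(4,5)[OF G(2)] by auto
  \<comment> \<open>\<open>k a\<close> carries the range of \<open>V\<close> onto the eigenspace
    with outcome \<open>a\<close>. It moves all four outcome pairs back to the same
    \<open>V\<close>, at the price of replacing \<open>A\<close> by \<open>C a b A\<close>.\<close>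
  define k where "k a = (if a = 0 then 1\<^sub>m ?D else h)" for a :: nat
  have k: "k a \<in> G" for a using D(3) G(3) by (simp add: k_def)
  have dk [simp]: "dim_row (k a) = ?D" "dim_col (k a) = ?D" for a using D(4,5)[OF k] by auto
  define W where "W a = k a * V" for a
  have dW [simp]: "dim_row (W a) = ?D" "dim_col (W a) = d" for a by (auto simp: W_def)
  have W: "W a \<in> carrier_mat ?D d" for a by (rule carrier_matI) simp_all
  have W01: "W 0 * mat_adjoint (W 0) + W (Suc 0) * mat_adjoint (W (Suc 0)) = 1\<^sub>m ?D"
    using compl by (simp add: W_def k_def)
  define C where "C a b A = mat_adjoint (k b) * (A * k a)" for a b A
  have CG: "C a b A \<in> G" if "A \<in> G" for a b A
    unfolding C_def using D(7)[OF D(9)[OF k] D(7)[OF that k]] .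
  have chiC: "chi (C a b A) g = chi (k b) g * chi (k a) g * chi A g" if "A \<in> G" for a b A
    unfolding C_def chi_mult_left[OF G(1) D(9)[OF k] D(7)[OF that k] G(2)] chi_mult_left[OF G(1) that k G(2)]
      chi_adjoint[OF G(1) k G(2)] by simp
  define S where "S a b = (\<lambda>A. mat_adjoint V * (C a b A * V)) ` {A \<in> T. chi (C a b A) g = 1}" for a b
  have WAW: "mat_adjoint (W b) * A * W a = mat_adjoint V * (C a b A * V)" if "A \<in> G" for a b A
    using D(4,5)[OF that] unfolding W_def C_def by (simp add: adjoint_mult mat_mult_assoc)
  \<comment> \<open>An element anticommuting with \<open>g\<close> maps the eigenspace to the
    orthogonal one. Algebraically, moving \<open>g\<close> through \<open>B\<close> gives e = -e as
    factors of the compression.\<close>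
  have vanish: "mat_adjoint V * (B * V) = 0\<^sub>m d d" if B: "B \<in> G" "chi B g \<noteq> 1" for B
  proof -
    have [simp]: "dim_row B = ?D" "dim_col B = ?D" using D(4,5)[OF B(1)] by auto
    have "B * g = (-1) \<cdot>\<^sub>m (g * B)" using chi_eq[OF G(1) B(1) G(2)] B(2) chi_pm[of B g] by auto
    then have "mat_adjoint V * ((B * g) * V) = (-1) \<cdot>\<^sub>m ((mat_adjoint V * g) * (B * V))"
      by (simp add: mat_algebra)
    moreover have "mat_adjoint V * ((B * g) * V) = e \<cdot>\<^sub>m (mat_adjoint V * (B * V))"
      by (simp add: mat_mult_assoc V(4)) (simp add: mat_algebra)
    ultimately have eq: "e \<cdot>\<^sub>m (mat_adjoint V * (B * V)) = (- e) \<cdot>\<^sub>m (mat_adjoint V * (B * V))"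
      unfolding Vg by (simp add: mat_algebra)
    show ?thesis
    proof (intro eq_matI)
      fix i j assume "i < dim_row (0\<^sub>m d d :: complex mat)" "j < dim_col (0\<^sub>m d d :: complex mat)"
      then have ij: "i < d" "j < d" by auto
      have "e * (mat_adjoint V * (B * V)) $$ (i, j) = - e * (mat_adjoint V * (B * V)) $$ (i, j)"
        using arg_cong[OF eq, of "\<lambda>M. M $$ (i, j)"] ij by (simp del: index_mult_mat(1))
      then show "(mat_adjoint V * (B * V)) $$ (i, j) = (0\<^sub>m d d :: complex mat) $$ (i, j)"
        using V(3) ij by (simp del: index_mult_mat(1))
    qed auto
  qed
  have TD: "T \<subseteq> carrier_mat ?D ?D" using G(4) D(6) by blast
  have span: "mat_adjoint (W b) * X * W a \<in> mspan d (S a b)" if "X \<in> mspan ?D T" for X a b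
    using that
  proof induction
    case zero
    have "mat_adjoint (W b) * 0\<^sub>m ?D ?D * W a = 0\<^sub>m d d" by simp
    then show ?case by (simp only: mspan.zero)
  next
    case (add X A c)
    have X: "X \<in> carrier_mat ?D ?D" using mspan_carrier[OF TD add.hyps(1)] .
    have AG: "A \<in> G" using add.hyps(2) G(4) by blast
    have eq: "mat_adjoint (W b) * (X + c \<cdot>\<^sub>m A) * W a =
        mat_adjoint (W b) * X * W a + c \<cdot>\<^sub>m (mat_adjoint (W b) * A * W a)"
      using X D(4,5)[OF AG] by (simp add: mat_algebra)
    show ?case
    proof (cases "chi (C a b A) g = 1")
      case True
      then have "mat_adjoint (W b) * A * W a \<in> S a b" unfolding WAW[OF AG] S_def using add.hyps by blast
      then show ?thesis unfolding eq by (rule mspan.add[OF add.IH])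
    next
      case False
      have "mat_adjoint (W b) * A * W a = 0\<^sub>m d d" unfolding WAW[OF AG] by (rule vanish[OF CG[OF AG] False])
      then have "mat_adjoint (W b) * (X + c \<cdot>\<^sub>m A) * W a = mat_adjoint (W b) * X * W a"
        unfolding eq by (intro eq_matI) (auto simp del: index_mult_mat(1))
      then show ?thesis using add.IH by simp
    qed
  qed
  have "\<exists>P. resolves n (S a b) s P" for a b
  proof (rule IH[OF G'])
    show "S a b \<subseteq> (\<lambda>A. mat_adjoint V * (A * V)) ` {A \<in> G. chi A g = 1}"
      unfolding S_def using CG G(4) by blast
    \<comment> \<open>The two frame changes multiply the sign of every candidate by the same factor,
      so the survivors are exactly one half of the splitting.\<close>
    have "{A \<in> T. chi (C a b A) g = 1} = {A \<in> T. chi A g = chi (k b) g * chi (k a) g}"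
      using chiC G(4) chi_pm[of "k b" g] chi_pm[of "k a" g] by fastforce
    moreover have "chi (k b) g * chi (k a) g = 1 \<or> chi (k b) g * chi (k a) g = -1"
      using chi_pm[of "k b" g] chi_pm[of "k a" g] by fastforce
    ultimately have "card {A \<in> T. chi (C a b A) g = 1} \<le> N" using T(2,3) by (elim disjE) simp_all
    then show "card (S a b) \<le> N"
      unfolding S_def by (rule order_trans[OF card_image_le, rotated]) (use T(1) in simp)
  qed
  then obtain Q where Q: "\<And>a b. resolves n (S a b) s (Q a b)" by metis
  \<comment> \<open>An operator on Alice's side multiplies X from the right by its transpose, so she
    applies the transposes of the \<open>W a\<close>. The continuation \<open>Q a b\<close> depends
    on both outcomes, hence on communication in both directions.\<close>
  let ?P = "Local Alice d [[transpose_mat (W 0)], [transpose_mat (W (Suc 0))]]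
    (\<lambda>a. Local Bob d [[mat_adjoint (W 0)], [mat_adjoint (W (Suc 0))]] (Q a))"
  have Wt: "transpose_mat (W a) \<in> carrier_mat d ?D" for a using W by simp
  have Wa: "mat_adjoint (W a) \<in> carrier_mat d ?D" for a using W by simp
  have Q2: "well_formed (Q a b) d d" for a b using Q[of a b] by (simp add: resolves_def d_def)
  have supA: "superoperator ?D d [transpose_mat (W 0), transpose_mat (W (Suc 0))]"
  proof (rule superoperator_pair[OF Wt Wt])
    have "transpose_mat (W 0 * mat_adjoint (W 0)) + transpose_mat (W (Suc 0) * mat_adjoint (W (Suc 0))) =
        transpose_mat (W 0 * mat_adjoint (W 0) + W (Suc 0) * mat_adjoint (W (Suc 0)))"
      by (intro eq_matI) (auto simp del: index_mult_mat(1))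
    then show "mat_adjoint (transpose_mat (W 0)) * transpose_mat (W 0) +
        mat_adjoint (transpose_mat (W (Suc 0))) * transpose_mat (W (Suc 0)) = 1\<^sub>m ?D"
      unfolding adjoint_transpose W01 by simp
  qed
  have supB: "superoperator ?D d [mat_adjoint (W 0), mat_adjoint (W (Suc 0))]"
    by (rule superoperator_pair[OF Wa Wa]) (simp add: W01)
  have wf: "well_formed ?P ?D ?D" using supA supB Q2 by simp
  have "n \<le> m + s \<and> (\<exists>c. \<sigma> = c \<cdot>\<^sub>m dens (2 ^ m) (2 ^ m) [1\<^sub>m (2 ^ m)])"
    if Xs: "set Xs \<subseteq> mspan ?D T" and r: "(m, \<sigma>) \<in> results ?P ?D ?D (dens ?D ?D Xs)" for Xs m \<sigma>
  proof -
    have Xc: "set Xs \<subseteq> carrier_mat ?D ?D" using mspan_carrier[OF TD] Xs by blast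
    have two: "i < 2 \<Longrightarrow> [[transpose_mat (W 0)], [transpose_mat (W (Suc 0))]] ! i = [transpose_mat (W i)]"
      "i < 2 \<Longrightarrow> [[mat_adjoint (W 0)], [mat_adjoint (W (Suc 0))]] ! i = [mat_adjoint (W i)]" for i :: nat
      by (auto simp: less_2_cases_iff)
    let ?YA = "\<lambda>a. map (\<lambda>X. 1\<^sub>m ?D * X * transpose_mat (transpose_mat (W a))) Xs"
    have A: "apply_kraus (d * ?D) [tensor_mat (transpose_mat (W a)) (1\<^sub>m ?D)] (dens ?D ?D Xs) = dens d ?D (?YA a)" for a
      by (rule apply_kraus_tensor[OF Wt one_carrier_mat Xc])
    let ?YB = "\<lambda>a b. map (\<lambda>X. mat_adjoint (W b) * X * transpose_mat (1\<^sub>m d)) (?YA a)"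
    have B: "apply_kraus (d * d) [tensor_mat (1\<^sub>m d) (mat_adjoint (W b))] (dens d ?D (?YA a)) = dens d d (?YB a b)" for a b
      by (rule apply_kraus_tensor[OF one_carrier_mat Wa]) (use Xc in \<open>auto intro!: carrier_matI\<close>)
    have YB: "?YB a b = map (\<lambda>X. mat_adjoint (W b) * X * W a) Xs" for a b
      using Xc by (auto simp: mat_mult_assoc)
    from r obtain a b where "a < 2" "b < 2" and "(m, \<sigma>) \<in> results (Q a b) d d (dens d d (?YB a b))"
      by (auto simp: two A B numeral_2_eq_2[symmetric] simp del: One_nat_def map_map transpose_transpose transpose_one)
    then have "(m, \<sigma>) \<in> results (Q a b) d d (dens d d (map (\<lambda>X. mat_adjoint (W b) * X * W a) Xs))"
      unfolding YB by simp
    moreover have "set (map (\<lambda>X. mat_adjoint (W b) * X * W a) Xs) \<subseteq> mspan d (S a b)"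
      using span Xs by auto
    ultimately show ?thesis using Q[of a b] unfolding resolves_def d_def[symmetric] by blast
  qed
  then have "resolves (Suc n) T (Suc s) ?P"
    unfolding resolves_def power_Suc d_def[symmetric] using wf by fastforce
  then show ?thesis by blast
qed

text \<open>Each level first discards proportional candidates. Either few enough remain already, or
  a balanced splitting is measured. The generality in \<open>n\<close>, \<open>G\<close> and
  \<open>S\<close> is essential, since the recursion continues in the restricted group.\<close>

lemma resolves_exists:
  "error_group (2 ^ n) G \<Longrightarrow> S \<subseteq> G \<Longrightarrow> card S \<le> capacity s \<Longrightarrow> \<exists>P. resolves n S s P"
proof (induction s arbitrary: n G S)
  case 0
  note D = error_groupD[OF 0(1)]
  have "finite S" using 0(2) D(2) by (rule finite_subset)
  moreover have "card S \<le> 1" using 0(3) by (simp add: capacity_def)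
  ultimately consider "S = {}" | A where "S = {A}"
    by (metis card_1_singletonE card_0_eq le_Suc_eq le_zero_eq One_nat_def)
  then show ?case
  proof cases
    case 1
    then show ?thesis using resolves_singleton[OF 0(1) D(3), of S] by blast
  next
    case (2 A)
    then show ?thesis using resolves_singleton[OF 0(1), of A S] 0(2) by blast
  qed
next
  case (Suc s)
  note D = error_groupD[OF Suc.prems(1)]
  have "finite S" using Suc.prems(2) D(2) finite_subset by blast
  from exists_independent_subset[OF this] obtain T where T0: "T \<subseteq> S \<and> (\<forall>A\<in>S. \<exists>B\<in>T. \<exists>c. A = c \<cdot>\<^sub>m B) \<and>
      (\<forall>A\<in>T. \<forall>B\<in>T. A \<noteq> B \<longrightarrow> \<not> (\<exists>c. A = c \<cdot>\<^sub>m B))"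
    by (rule exE)
  have T: "T \<subseteq> S" "\<And>A. A \<in> S \<Longrightarrow> \<exists>B\<in>T. \<exists>c. A = c \<cdot>\<^sub>m B"
    and ind: "\<And>A B. A \<in> T \<Longrightarrow> B \<in> T \<Longrightarrow> A \<noteq> B \<Longrightarrow> \<nexists>c. A = c \<cdot>\<^sub>m B"
    using T0 by simp_all
  have fT: "finite T" "T \<subseteq> G" "card T \<le> capacity (Suc s)"
    using T(1) \<open>finite S\<close> Suc.prems(2) finite_subset card_mono[OF \<open>finite S\<close> T(1)] Suc.prems(3)
    by (blast, blast, linarith)
  show ?case
  proof (cases "card T \<le> capacity s")
    case True
    then obtain P where "resolves n T s P" using Suc.IH[OF Suc.prems(1) fT(2)] by blast
    then have "resolves n S (Suc s) P" by (rule resolves_mono[OF _ _ T(2)]) simp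
    then show ?thesis by (rule exI)
  next
    case False
    have "1 \<le> capacity s"
    proof (cases "s = 0")
      case False
      have "(1 :: nat) \<le> 2 ^ (s - 1)" by simp
      also have "\<dots> \<le> capacity s" using False by (intro capacity_ge) simp
      finally show ?thesis .
    qed (simp add: capacity_def)
    then have T2: "2 \<le> card T" using False by simp
    let ?f = "\<lambda>B A. if A \<in> G then chi A B else 1"
    have sep: "\<exists>f\<in>?f ` G. f A \<noteq> f B" if "A \<in> T" "B \<in> T" "A \<noteq> B" for A B
    proof -
      have AB: "A \<in> G" "B \<in> G" using that fT(2) by auto
      have "\<exists>C\<in>G. chi A C \<noteq> chi B C"
        by (rule chi_separates[OF Suc.prems(1) AB ind[OF that]])
      then show ?thesis using AB by auto
    qed
    obtain g where g: "g \<in> G" "card {A \<in> T. ?f g A = 1} \<le> capacity s" "card {A \<in> T. ?f g A = -1} \<le> capacity s"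
      using balanced_split[OF sign_group_chi[OF Suc.prems(1)] fT(1) T2 fT(3) sep] by blast
    have eq: "{A \<in> T. ?f g A = c} = {A \<in> T. chi A g = c}" for c
      using fT(2) by auto
    \<comment> \<open>Neither half may be all of \<open>T\<close>, which exceeds
      \<open>capacity s\<close>; so some candidate anticommutes with \<open>g\<close> and can serve
      to swap its eigenspaces.\<close>
    have "\<exists>h\<in>T. chi h g = -1"
    proof (rule ccontr)
      assume "\<not> ?thesis"
      then have "{A \<in> T. chi A g = 1} = T" using chi_pm by blast
      then show False using g(2) False unfolding eq by simp
    qed
    then obtain h where h: "h \<in> G" "chi h g = -1" using fT(2) by blast
    \<comment> \<open>A pair is left to be measured: in dimension 1 all matrices commute,
      contradicting the choice of \<open>h\<close>.\<close>
    obtain n' where n: "n = Suc n'"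
    proof (cases n)
      case 0
      have dims: "dim_row h = 1" "dim_col h = 1" "dim_row g = 1" "dim_col g = 1"
        using D(4,5)[OF h(1)] D(4,5)[OF g(1)] 0 by auto
      have "h * g = g * h"
        by (intro eq_matI) (use dims in \<open>auto simp: index_mult_sum simp del: index_mult_mat(1)\<close>)
      then show ?thesis using h(2) by (simp add: chi_def)
    qed
    have "error_group (2 * 2 ^ n') G" using Suc.prems(1) n by simp
    then have "\<exists>P. resolves (Suc n') T (Suc s) P"
      by (rule resolves_step[OF _ g(1) h(1) fT(2) h(2) fT(1) g(2)[unfolded eq] g(3)[unfolded eq]])
        (rule Suc.IH)
    then obtain P where "resolves n T (Suc s) P" unfolding n by (rule exE)
    then have "resolves n S (Suc s) P" by (rule resolves_mono[OF _ order_refl T(2)])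
    then show ?thesis by (rule exI)
  qed
qed

section \<open>Pauli errors\<close>

unbundle bit_operations_syntax

section \<open>Bit vectors and their characters\<close>

lemma bit_less_imp:
  fixes x :: nat
  assumes "x < 2 ^ n" "bit x q"
  shows "q < n"
proof -
  have "take_bit n x = x" using assms(1) by (simp add: take_bit_nat_eq_self)
  then show ?thesis using assms(2) by (metis bit_take_bit_iff)
qed

lemma eq_of_bits:
  fixes x y :: nat
  assumes "x < 2 ^ n" "y < 2 ^ n" "\<And>q. q < n \<Longrightarrow> bit x q = bit y q"
  shows "x = y"
  by (rule bit_eqI) (use assms bit_less_imp in blast)

lemma xor_less: "x < 2 ^ n \<Longrightarrow> y < 2 ^ n \<Longrightarrow> x XOR y < (2 ^ n :: nat)"
  by (metis take_bit_nat_eq_self_iff take_bit_xor)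

lemma xor_cancel [simp]: "(x XOR y) XOR y = (x :: nat)"
  by (simp add: xor.assoc)

text \<open>The character (-1)^(v.y), with v.y the inner product of the first \<open>n\<close>
  bits.\<close>

definition bsign :: "nat \<Rightarrow> nat \<Rightarrow> nat \<Rightarrow> complex" where
  "bsign n v y = (\<Prod>q<n. if bit v q \<and> bit y q then -1 else 1)"

lemma bsign_commute: "bsign n v y = bsign n y v"
  by (simp add: bsign_def conj_commute)

lemma bsign_xor: "bsign n v (y XOR z) = bsign n v y * bsign n v z"
  unfolding bsign_def prod.distrib[symmetric] by (intro prod.cong) (auto simp: bit_xor_iff)

lemma bsign_xor_left: "bsign n (v XOR w) y = bsign n v y * bsign n w y"
  by (metis bsign_xor bsign_commute)

lemma bsign_0 [simp]: "bsign n 0 y = 1" "bsign n v 0 = 1"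
  by (simp_all add: bsign_def)

lemma bsign_sq [simp]: "bsign n v y * bsign n v y = 1"
  by (simp flip: bsign_xor)

lemma bsign_pm: "bsign n v y = 1 \<or> bsign n v y = -1"
  by (rule square_eq_1_iff[THEN iffD1, OF bsign_sq])

lemma cnj_bsign [simp]: "cnj (bsign n v y) = bsign n v y"
  using bsign_pm[of n v y] by auto

lemma bsign_power: "q < n \<Longrightarrow> bsign n v (2 ^ q) = (if bit v q then -1 else 1)"
proof -
  assume q: "q < n"
  have "bsign n v (2 ^ q) = (\<Prod>p<n. if p = q then (if bit v q then -1 else 1) else 1)"
    unfolding bsign_def by (intro prod.cong) (auto simp: bit_exp_iff)
  then show ?thesis using q by simp
qed

lemma bsign_trivial:
  assumes "v < 2 ^ n" "\<And>u. u < 2 ^ n \<Longrightarrow> bsign n v u = 1"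
  shows "v = 0"
proof (rule eq_of_bits[OF assms(1)])
  fix q assume q: "q < n"
  have "(2::nat) ^ q < 2 ^ n" using q by simp
  then show "bit v q = bit 0 q" using assms(2)[of "2 ^ q"] bsign_power[OF q, of v] by (auto split: if_splits)
qed simp

text \<open>The operator X^u Z^v. Where both bits are set it is Pauli Y up to a phase, so all
  entries are real and signs are the only phases needed.\<close>

definition pauli :: "nat \<Rightarrow> nat \<Rightarrow> nat \<Rightarrow> complex mat" where
  "pauli n u v = mat (2 ^ n) (2 ^ n) (\<lambda>(x, y). if x = y XOR u then bsign n v y else 0)"

lemma pauli_carrier [simp]: "pauli n u v \<in> carrier_mat (2 ^ n) (2 ^ n)"
  and pauli_dims [simp]: "dim_row (pauli n u v) = 2 ^ n" "dim_col (pauli n u v) = 2 ^ n"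
  by (simp_all add: pauli_def)

lemma pauli_mult:
  assumes "u' < 2 ^ n"
  shows "pauli n u v * pauli n u' v' = bsign n v u' \<cdot>\<^sub>m pauli n (u XOR u') (v XOR v')"
proof (intro eq_matI)
  fix x y assume "x < dim_row (bsign n v u' \<cdot>\<^sub>m pauli n (u XOR u') (v XOR v'))"
    "y < dim_col (bsign n v u' \<cdot>\<^sub>m pauli n (u XOR u') (v XOR v'))"
  then have xy: "x < 2 ^ n" "y < 2 ^ n" by auto
  have "(pauli n u v * pauli n u' v') $$ (x, y) = (\<Sum>k<2 ^ n. pauli n u v $$ (x, k) * pauli n u' v' $$ (k, y))"
    using xy by (simp add: index_mult_sum del: index_mult_mat(1))
  also have "\<dots> = (\<Sum>k<2 ^ n. if k = y XOR u' then (if x = k XOR u then bsign n v k else 0) * bsign n v' y else 0)"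
    using xy by (intro sum.cong) (auto simp: pauli_def)
  also have "\<dots> = (if x = (y XOR u') XOR u then bsign n v (y XOR u') else 0) * bsign n v' y"
    using xor_less[OF xy(2) assms] by simp
  also have "(y XOR u') XOR u = y XOR (u XOR u')" by (simp only: xor.assoc xor.commute[of u' u])
  finally show "(pauli n u v * pauli n u' v') $$ (x, y) =
      (bsign n v u' \<cdot>\<^sub>m pauli n (u XOR u') (v XOR v')) $$ (x, y)"
    using xy by (simp add: pauli_def bsign_xor bsign_xor_left mult_ac del: index_mult_mat(1))
qed auto

lemma pauli_0: "pauli n 0 0 = 1\<^sub>m (2 ^ n)"
  by (intro eq_matI) (auto simp: pauli_def)

lemma adjoint_pauli:
  assumes "u < 2 ^ n"
  shows "mat_adjoint (pauli n u v) = bsign n v u \<cdot>\<^sub>m pauli n u v"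
proof (intro eq_matI)
  fix x y assume "x < dim_row (bsign n v u \<cdot>\<^sub>m pauli n u v)" "y < dim_col (bsign n v u \<cdot>\<^sub>m pauli n u v)"
  then have xy: "x < 2 ^ n" "y < 2 ^ n" by auto
  have "mat_adjoint (pauli n u v) $$ (x, y) = (if y = x XOR u then bsign n v x else 0)"
    using xy by (simp add: pauli_def)
  also have "\<dots> = (if x = y XOR u then bsign n v (y XOR u) else 0)"
    by auto
  finally show "mat_adjoint (pauli n u v) $$ (x, y) = (bsign n v u \<cdot>\<^sub>m pauli n u v) $$ (x, y)"
    using xy by (simp add: pauli_def bsign_xor)
qed auto

lemma smult_pauli_cancel:
  assumes "c \<cdot>\<^sub>m pauli n u v = e \<cdot>\<^sub>m pauli n u v" "u < 2 ^ n"
  shows "c = e"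
proof -
  have "(c \<cdot>\<^sub>m pauli n u v) $$ (u, 0) = (e \<cdot>\<^sub>m pauli n u v) $$ (u, 0)" using assms(1) by simp
  then show ?thesis using assms(2) by (simp add: pauli_def)
qed

text \<open>With only the phases 1 and -1, members may be skew-adjoint, as
  \<open>error_group\<close> permits.\<close>

definition pauli_group :: "nat \<Rightarrow> complex mat set" where
  "pauli_group n = (\<lambda>(c, u, v). c \<cdot>\<^sub>m pauli n u v) ` ({1, -1} \<times> {..<2 ^ n} \<times> {..<2 ^ n})"

lemma pauli_groupI: "c = 1 \<or> c = -1 \<Longrightarrow> u < 2 ^ n \<Longrightarrow> v < 2 ^ n \<Longrightarrow> c \<cdot>\<^sub>m pauli n u v \<in> pauli_group n"
  unfolding pauli_group_def by (rule image_eqI[where x = "(c, u, v)"]) auto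

lemma pauli_groupE:
  assumes "A \<in> pauli_group n"
  obtains c u v where "A = c \<cdot>\<^sub>m pauli n u v" "c = 1 \<or> c = -1" "u < 2 ^ n" "v < 2 ^ n"
  using assms unfolding pauli_group_def by auto

lemma pauli_in_group: "u < 2 ^ n \<Longrightarrow> v < 2 ^ n \<Longrightarrow> pauli n u v \<in> pauli_group n"
  using pauli_groupI[of 1 u n v] by (simp add: smult_one)

lemma smult_pauli_mult:
  assumes "u' < 2 ^ n"
  shows "(c \<cdot>\<^sub>m pauli n u v) * (e \<cdot>\<^sub>m pauli n u' v') =
     (c * e * bsign n v u') \<cdot>\<^sub>m pauli n (u XOR u') (v XOR v')"
  using pauli_mult[OF assms] by (simp add: mat_algebra mult_ac)

lemma error_group_pauli: "error_group (2 ^ n) (pauli_group n)"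
proof -
  have mult: "A * B \<in> pauli_group n \<and> (A * B = B * A \<or> A * B = - (B * A))"
    if AB: "A \<in> pauli_group n" "B \<in> pauli_group n" for A B
  proof -
    obtain c u v where A: "A = c \<cdot>\<^sub>m pauli n u v" "c = 1 \<or> c = -1" "u < 2 ^ n" "v < 2 ^ n"
      by (rule pauli_groupE[OF AB(1)])
    obtain e u' v' where B: "B = e \<cdot>\<^sub>m pauli n u' v'" "e = 1 \<or> e = -1" "u' < 2 ^ n" "v' < 2 ^ n"
      by (rule pauli_groupE[OF AB(2)])
    have AB: "A * B = (c * e * bsign n v u') \<cdot>\<^sub>m pauli n (u XOR u') (v XOR v')"
      unfolding A(1) B(1) by (rule smult_pauli_mult[OF B(3)])
    have BA: "B * A = (c * e * bsign n v' u) \<cdot>\<^sub>m pauli n (u XOR u') (v XOR v')"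
      unfolding A(1) B(1) smult_pauli_mult[OF A(3)] by (simp add: xor.commute mult_ac)
    have "A * B \<in> pauli_group n"
      unfolding AB by (rule pauli_groupI) (use A B bsign_pm[of n v u'] xor_less in auto)
    moreover have "bsign n v u' = bsign n v' u \<or> bsign n v u' = - bsign n v' u"
      using bsign_pm[of n v u'] bsign_pm[of n v' u] by auto
    then have "A * B = B * A \<or> A * B = - (B * A)"
      unfolding AB BA by (auto simp: uminus_smult smult_smult)
    ultimately show ?thesis by blast
  qed
  have adj: "mat_adjoint A \<in> pauli_group n \<and> (mat_adjoint A = A \<or> mat_adjoint A = - A) \<and>
      mat_adjoint A * A = 1\<^sub>m (2 ^ n)" if "A \<in> pauli_group n" for A
  proof -
    from that obtain c u v where A: "A = c \<cdot>\<^sub>m pauli n u v" "c = 1 \<or> c = -1" "u < 2 ^ n" "v < 2 ^ n"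
      by (rule pauli_groupE)
    have eq: "mat_adjoint A = (c * bsign n v u) \<cdot>\<^sub>m pauli n u v"
      unfolding A(1) adjoint_smult adjoint_pauli[OF A(3)] smult_smult using A(2) by auto
    have "mat_adjoint A \<in> pauli_group n"
      unfolding eq by (rule pauli_groupI) (use A bsign_pm[of n v u] in auto)
    moreover have "mat_adjoint A = A \<or> mat_adjoint A = - A"
      unfolding eq unfolding A(1) using bsign_pm[of n v u] by (auto simp: uminus_smult smult_smult)
    moreover have "mat_adjoint A * A = 1\<^sub>m (2 ^ n)"
    proof -
      have "mat_adjoint A * A = (c * c * (bsign n v u * bsign n v u)) \<cdot>\<^sub>m pauli n 0 0"
        unfolding eq unfolding A(1) smult_pauli_mult[OF A(3)] by (simp add: mult_ac)
      moreover have "c * c = 1" using A(2) by auto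
      ultimately show ?thesis unfolding bsign_sq by (simp add: pauli_0 smult_one)
    qed
    ultimately show ?thesis by blast
  qed
  have cen: "\<exists>c. A = c \<cdot>\<^sub>m 1\<^sub>m (2 ^ n)"
    if A0: "A \<in> pauli_group n" and com: "\<forall>B\<in>pauli_group n. A * B = B * A" for A
  proof -
    obtain c u v where A: "A = c \<cdot>\<^sub>m pauli n u v" "c = 1 \<or> c = -1" "u < 2 ^ n" "v < 2 ^ n"
      by (rule pauli_groupE[OF A0])
    \<comment> \<open>Comparing the two products with a test operator gives equal signs. Tests with
      v' = 0 then force v = 0, and tests with u' = 0 force u = 0, by nondegeneracy of the sign
      form.\<close>
    have eq: "bsign n v u' = bsign n v' u" if uv: "u' < 2 ^ n" "v' < 2 ^ n" for u' v'
    proof -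
      have "A * (1 \<cdot>\<^sub>m pauli n u' v') = (1 \<cdot>\<^sub>m pauli n u' v') * A"
        using com pauli_groupI[OF _ uv, of 1] by blast
      then have "(c * bsign n v u') \<cdot>\<^sub>m pauli n (u XOR u') (v XOR v') =
          (c * bsign n v' u) \<cdot>\<^sub>m pauli n (u XOR u') (v XOR v')"
        unfolding A(1) smult_pauli_mult[OF A(3)] smult_pauli_mult[OF uv(1)]
        by (simp add: xor.commute)
      then have "c * bsign n v u' = c * bsign n v' u"
        by (rule smult_pauli_cancel) (rule xor_less[OF A(3) uv(1)])
      then show ?thesis using A(2) by auto
    qed
    have "v = 0" by (rule bsign_trivial[OF A(4)]) (use eq[of _ 0] in simp)
    moreover have "u = 0"
    proof (rule bsign_trivial[OF A(3)])
      fix v' :: nat assume "v' < 2 ^ n"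
      then have "bsign n v' u = 1" using eq[of 0 v'] by simp
      then show "bsign n u v' = 1" by (simp add: bsign_commute)
    qed
    ultimately show ?thesis using A(1) pauli_0 by auto
  qed
  have "finite (pauli_group n)" unfolding pauli_group_def by simp
  moreover have "pauli_group n \<subseteq> carrier_mat (2 ^ n) (2 ^ n)"
    unfolding pauli_group_def by auto
  moreover have "1\<^sub>m (2 ^ n) \<in> pauli_group n"
    using pauli_in_group[of 0 n 0] by (simp add: pauli_0)
  ultimately show ?thesis
    unfolding error_group_def using mult adj cen by (intro conjI ballI impI) simp_all
qed

section \<open>Pauli expansion of operators on few qubits\<close>

definition masks :: "nat set \<Rightarrow> nat set" where
  "masks T = {u. \<forall>q. bit u q \<longrightarrow> q \<in> T}"

lemma bit_set_encode: "finite U \<Longrightarrow> bit (set_encode U) q \<longleftrightarrow> q \<in> U"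
proof -
  assume "finite U"
  then have "q \<in> U \<longleftrightarrow> q \<in> set_decode (set_encode U)" by simp
  then show ?thesis by (simp add: set_decode_def bit_iff_odd)
qed

lemma masks_eq:
  assumes "finite T"
  shows "masks T = set_encode ` Pow T"
proof (intro equalityI subsetI)
  fix u assume u: "u \<in> masks T"
  then have "set_decode u \<subseteq> T" by (auto simp: masks_def set_decode_def bit_iff_odd)
  then show "u \<in> set_encode ` Pow T" by (intro image_eqI[where x = "set_decode u"]) simp_all
next
  fix u assume "u \<in> set_encode ` Pow T"
  then obtain U where U: "u = set_encode U" "U \<subseteq> T" by blast
  then have "finite U" using assms finite_subset by blast
  then show "u \<in> masks T" using U(2) unfolding U(1) masks_def by (auto simp: bit_set_encode)
qed

lemma masks_less:
  assumes "T \<subseteq> {..<n}" "u \<in> masks T"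
  shows "u < 2 ^ n"
proof -
  have "take_bit n u = u"
    by (rule bit_eqI) (use assms in \<open>auto simp: bit_take_bit_iff masks_def\<close>)
  then show ?thesis using take_bit_nat_less_exp[of n u] by simp
qed

text \<open>Character orthogonality on the qubits in \<open>T\<close>: the sum factors into one term
  1 + 1 or 1 - 1 per qubit.\<close>

lemma sum_bsign_masks:
  assumes "T \<subseteq> {..<n}"
  shows "(\<Sum>v\<in>masks T. bsign n v z) = (if \<forall>q\<in>T. \<not> bit z q then 2 ^ card T else 0)"
proof -
  have fT: "finite T" using assms finite_subset by blast
  have inj: "inj_on set_encode (Pow T)"
    by (rule inj_on_subset[OF inj_on_set_encode]) (use fT finite_subset in auto)
  have b: "bsign n (set_encode V) z = (\<Prod>q\<in>V. if bit z q then -1 else 1)" if V: "V \<in> Pow T" for V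
  proof -
    have fV: "finite V" "V \<subseteq> {..<n}" using V fT assms finite_subset by auto
    have "bsign n (set_encode V) z = (\<Prod>q<n. if q \<in> V then (if bit z q then -1 else 1) else 1)"
      unfolding bsign_def by (intro prod.cong) (auto simp: bit_set_encode[OF fV(1)])
    also have "\<dots> = (\<Prod>q\<in>{..<n} \<inter> V. if bit z q then -1 else 1)" by (simp flip: prod.inter_restrict)
    finally show ?thesis using fV(2) by (simp add: Int_absorb1)
  qed
  have "(\<Sum>v\<in>masks T. bsign n v z) = (\<Sum>V\<in>Pow T. (\<Prod>q\<in>V. if bit z q then -1 else 1) * (\<Prod>q\<in>T - V. 1))"
    unfolding masks_eq[OF fT] by (simp add: sum.reindex[OF inj] b)
  also have "\<dots> = (\<Prod>q\<in>T. (if bit z q then -1 else 1) + (1 :: complex))"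
    using prod_add[OF fT, of "\<lambda>q. if bit z q then -1 else 1" "\<lambda>_. 1 :: complex"] by simp
  also have "\<dots> = (if \<forall>q\<in>T. \<not> bit z q then 2 ^ card T else 0)"
  proof (cases "\<forall>q\<in>T. \<not> bit z q")
    case True
    then have "(\<Prod>q\<in>T. (if bit z q then -1 else 1) + (1 :: complex)) = (\<Prod>q\<in>T. 2)"
      by (intro prod.cong) auto
    then show ?thesis using True by simp
  next
    case False
    then show ?thesis using fT by (auto intro!: prod_zero)
  qed
  finally show ?thesis .
qed

lemma sub_register_cong: "finite T \<Longrightarrow> (\<And>q. q \<in> T \<Longrightarrow> bit x q = bit y q) \<Longrightarrow> sub_register T x = sub_register T y"
  unfolding sub_register_def by (intro arg_cong[of _ _ "horner_sum of_bool 2"] map_cong refl) simp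

text \<open>Fourier inversion. At entry (x, y) only the shift u = x XOR y contributes, and along
  each shifted diagonal the entries are a function on the bits in \<open>T\<close>, hence a
  combination of the characters \<open>bsign n v\<close>.\<close>

lemma on_qubits_mspan:
  assumes T: "T \<subseteq> {..<n}"
  shows "on_qubits n T E \<in> mspan (2 ^ n) {pauli n u v | u v. u \<in> masks T \<and> v \<in> masks T}"
proof -
  have fT: "finite T" using T finite_subset by blast
  have fM: "finite (masks T)" unfolding masks_eq[OF fT] using fT by simp
  note less = masks_less[OF T]
  define f where "f x y = E $$ (sub_register T x, sub_register T y)" for x y
  \<comment> \<open>The Fourier coefficient at \<open>v\<close> of the diagonal shifted by
    \<open>u\<close>. Since \<open>f\<close> sees only the bits in \<open>T\<close>, it is enough to
    sum over masks.\<close>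
  define c where "c u v = (\<Sum>y\<in>masks T. f (y XOR u) y * bsign n v y) / 2 ^ card T" for u v
  have expand: "on_qubits n T E $$ (x, y) = (\<Sum>(u, v)\<in>masks T \<times> masks T. c u v * pauli n u v $$ (x, y))"
    if xy: "x < 2 ^ n" "y < 2 ^ n" for x y
  proof -
    have "(\<Sum>(u, v)\<in>masks T \<times> masks T. c u v * pauli n u v $$ (x, y)) =
        (\<Sum>u\<in>masks T. if u = x XOR y then \<Sum>v\<in>masks T. c u v * bsign n v y else 0)"
      unfolding sum.cartesian_product[symmetric]
    proof (intro sum.cong refl)
      fix u
      have "x = y XOR u \<longleftrightarrow> u = x XOR y" by (metis xor.commute xor_cancel)
      then show "(\<Sum>v\<in>masks T. c u v * pauli n u v $$ (x, y)) =
          (if u = x XOR y then \<Sum>v\<in>masks T. c u v * bsign n v y else 0)"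
        using xy by (simp add: pauli_def)
    qed
    also have "\<dots> = (if x XOR y \<in> masks T then \<Sum>v\<in>masks T. c (x XOR y) v * bsign n v y else 0)"
      using fM by simp
    also have "\<dots> = on_qubits n T E $$ (x, y)"
    proof (cases "x XOR y \<in> masks T")
      case False
      then obtain q where "bit (x XOR y) q" "q \<notin> T" by (auto simp: masks_def)
      moreover from this have "q < n" using bit_less_imp[OF xor_less[OF xy]] by blast
      ultimately have "\<not> (\<forall>q<n. q \<notin> T \<longrightarrow> bit x q = bit y q)" by (auto simp: bit_xor_iff)
      then show ?thesis using False xy by (auto simp: on_qubits_def)
    next
      case True
      define u where "u = x XOR y"
      \<comment> \<open>The only mask that agrees with \<open>y\<close> on \<open>T\<close>;
        orthogonality singles out its term.\<close>
      define y0 where "y0 = set_encode {q \<in> T. bit y q}"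
      have bit_y0: "bit y0 q \<longleftrightarrow> q \<in> T \<and> bit y q" for q
        unfolding y0_def using fT by (simp add: bit_set_encode)
      have y0: "y0 \<in> masks T" using bit_y0 by (simp add: masks_def)
      have agree: "(\<forall>q\<in>T. \<not> bit (y' XOR y) q) \<longleftrightarrow> y' = y0" if y': "y' \<in> masks T" for y'
      proof
        assume a: "\<forall>q\<in>T. \<not> bit (y' XOR y) q"
        show "y' = y0"
          by (rule bit_eqI) (use a y' bit_y0 in \<open>auto simp: bit_xor_iff masks_def\<close>)
      next
        assume "y' = y0"
        then show "\<forall>q\<in>T. \<not> bit (y' XOR y) q" using bit_y0 by (simp add: bit_xor_iff)
      qed
      have "(\<Sum>v\<in>masks T. c u v * bsign n v y) =
          (\<Sum>v\<in>masks T. \<Sum>y'\<in>masks T. f (y' XOR u) y' * bsign n v (y' XOR y) / 2 ^ card T)"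
        unfolding c_def sum_divide_distrib sum_distrib_right bsign_xor
        by (intro sum.cong refl) (simp add: mult_ac)
      also have "\<dots> = (\<Sum>y'\<in>masks T. \<Sum>v\<in>masks T. f (y' XOR u) y' * bsign n v (y' XOR y) / 2 ^ card T)"
        by (rule sum.swap)
      also have "\<dots> = (\<Sum>y'\<in>masks T. f (y' XOR u) y' * (\<Sum>v\<in>masks T. bsign n v (y' XOR y)) / 2 ^ card T)"
        by (simp add: sum_distrib_left sum_divide_distrib)
      also have "\<dots> = (\<Sum>y'\<in>masks T. if y' = y0 then f (y' XOR u) y' else 0)"
        by (intro sum.cong refl) (simp add: sum_bsign_masks[OF T] agree)
      also have "\<dots> = f (y0 XOR u) y0" using fM y0 by simp
      also have "\<dots> = f x y"
      proof -
        have "sub_register T (y0 XOR u) = sub_register T x"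
          by (rule sub_register_cong[OF fT]) (auto simp: bit_xor_iff bit_y0 u_def)
        moreover have "sub_register T y0 = sub_register T y"
          by (rule sub_register_cong[OF fT]) (auto simp: bit_y0)
        ultimately show ?thesis by (simp add: f_def)
      qed
      finally have "(\<Sum>v\<in>masks T. c (x XOR y) v * bsign n v y) = f x y" unfolding u_def .
      moreover have "\<forall>q<n. q \<notin> T \<longrightarrow> bit x q = bit y q"
        using True by (auto simp: masks_def bit_xor_iff)
      ultimately show ?thesis using True xy by (simp add: on_qubits_def f_def)
    qed
    finally show ?thesis by simp
  qed
  have "on_qubits n T E = mat (2 ^ n) (2 ^ n)
      (\<lambda>ij. \<Sum>k\<in>masks T \<times> masks T. (case k of (u, v) \<Rightarrow> c u v) * (case k of (u, v) \<Rightarrow> pauli n u v) $$ ij)"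
    by (intro eq_matI) (auto simp: expand on_qubits_def[of n T E, THEN arg_cong[of _ _ dim_row]]
        on_qubits_def[of n T E, THEN arg_cong[of _ _ dim_col]] case_prod_unfold)
  also have "\<dots> \<in> mspan (2 ^ n) {pauli n u v | u v. u \<in> masks T \<and> v \<in> masks T}"
    by (rule mspan_sum) (use fM in auto)
  finally show ?thesis .
qed

text \<open>The set of bits is the support of the operator, so these are the Pauli errors of weight
  at most \<open>t\<close>, each with one fixed phase.\<close>

definition errors :: "nat \<Rightarrow> nat \<Rightarrow> complex mat set" where
  "errors n t = {pauli n u v | u v. {q. bit u q \<or> bit v q} \<subseteq> {..<n} \<and> card {q. bit u q \<or> bit v q} \<le> t}"

lemma errors_subset: "errors n t \<subseteq> pauli_group n"
proof
  fix A assume "A \<in> errors n t"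
  then obtain u v where A: "A = pauli n u v" "{q. bit u q \<or> bit v q} \<subseteq> {..<n}"
    unfolding errors_def by blast
  then have "u \<in> masks {..<n}" "v \<in> masks {..<n}" by (auto simp: masks_def)
  then show "A \<in> pauli_group n" unfolding A(1) using masks_less by (intro pauli_in_group) auto
qed

lemma card_errors: "card (errors n t) \<le> (\<Sum>j=0..t. 3 ^ j * (n choose j))"
proof -
  \<comment> \<open>On the support \<open>W\<close>, the value 1 encodes Z (only the bit of v set),
    2 encodes X (only the bit of u) and 0 encodes both; this accounts for the factor 3 per affected
    qubit.\<close>
  define h where "h W f = pauli n (set_encode {q \<in> W. f q \<noteq> 1}) (set_encode {q \<in> W. f q \<noteq> 2})"
    for W and f :: "nat \<Rightarrow> nat"
  define Ws where "Ws j = {W. W \<subseteq> {..<n} \<and> card W = j}" for j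
  have fWs: "finite (Ws j)" for j unfolding Ws_def by simp
  have fW: "finite W" if "W \<in> Ws j" for W j using that finite_subset unfolding Ws_def by blast
  have sub: "errors n t \<subseteq> (\<Union>j\<in>{0..t}. \<Union>W\<in>Ws j. h W ` (W \<rightarrow>\<^sub>E {0, 1, 2}))"
  proof
    fix A assume "A \<in> errors n t"
    then obtain u v where A: "A = pauli n u v" and W: "{q. bit u q \<or> bit v q} \<subseteq> {..<n}"
      "card {q. bit u q \<or> bit v q} \<le> t"
      unfolding errors_def by blast
    define W where "W = {q. bit u q \<or> bit v q}"
    have fW: "finite W" using W(1) finite_subset unfolding W_def by blast
    define f :: "nat \<Rightarrow> nat" where "f = (\<lambda>q\<in>W. if \<not> bit u q then 1 else if \<not> bit v q then 2 else 0)"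
    have "u = set_encode {q \<in> W. f q \<noteq> 1}"
      by (rule bit_eqI) (use fW in \<open>auto simp: bit_set_encode f_def W_def\<close>)
    moreover have "v = set_encode {q \<in> W. f q \<noteq> 2}"
      by (rule bit_eqI) (use fW in \<open>auto simp: bit_set_encode f_def W_def\<close>)
    ultimately have "A = h W f" unfolding h_def A by simp
    moreover have "f \<in> W \<rightarrow>\<^sub>E {0, 1, 2}" by (auto simp: f_def)
    moreover have "W \<in> Ws (card W)" "card W \<in> {0..t}" using W unfolding Ws_def W_def by auto
    ultimately show "A \<in> (\<Union>j\<in>{0..t}. \<Union>W\<in>Ws j. h W ` (W \<rightarrow>\<^sub>E {0, 1, 2}))" by blast
  qed
  have fin: "finite (h W ` (W \<rightarrow>\<^sub>E {0, 1, 2}))" if "W \<in> Ws j" for W j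
    using fW[OF that] by (intro finite_imageI finite_PiE) auto
  have "card (errors n t) \<le> card (\<Union>j\<in>{0..t}. \<Union>W\<in>Ws j. h W ` (W \<rightarrow>\<^sub>E {0, 1, 2}))"
    by (rule card_mono[OF _ sub]) (use fWs fin in blast)
  also have "\<dots> \<le> (\<Sum>j=0..t. card (\<Union>W\<in>Ws j. h W ` (W \<rightarrow>\<^sub>E {0, 1, 2})))"
    by (rule card_UN_le) simp
  also have "\<dots> \<le> (\<Sum>j=0..t. \<Sum>W\<in>Ws j. 3 ^ j)"
  proof (intro sum_mono order_trans[OF card_UN_le] fWs)
    fix j W assume W: "W \<in> Ws j"
    have "card (h W ` (W \<rightarrow>\<^sub>E {0, 1, 2})) \<le> card (W \<rightarrow>\<^sub>E {0, 1, 2 :: nat})"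
      by (rule card_image_le) (use fW[OF W] in \<open>intro finite_PiE, auto\<close>)
    also have "\<dots> = 3 ^ j" using W fW[OF W] by (simp add: card_PiE Ws_def numeral_3_eq_3)
    finally show "card (h W ` (W \<rightarrow>\<^sub>E {0, 1, 2})) \<le> 3 ^ j" .
  qed
  also have "\<dots> = (\<Sum>j=0..t. 3 ^ j * (n choose j))"
    by (simp add: Ws_def n_subsets mult.commute)
  finally show ?thesis .
qed

section \<open>The main result\<close>

lemma epr_pairs_index:
  assumes "i < 2 ^ m * 2 ^ m"
  shows "epr_pairs m $ i = (if i mod 2 ^ m = i div 2 ^ m then (1 / complex_of_real (sqrt 2)) ^ m else 0)"
proof (cases "i mod 2 ^ m = i div 2 ^ m")
  case True
  then show ?thesis using assms by (simp add: epr_pairs_def epr_amplitude_def)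
next
  case False
  have "i div 2 ^ m < 2 ^ m" using assms by (simp add: less_mult_imp_div_less)
  then obtain q where "q < m" "bit (i mod 2 ^ m) q \<noteq> bit (i div 2 ^ m) q"
    using eq_of_bits[of "i mod 2 ^ m" m "i div 2 ^ m"] False by auto
  then have "(\<Prod>q<m. epr_amplitude (bit (i div 2 ^ m) q) (bit (i mod 2 ^ m) q)) = 0"
    by (intro prod_zero) (auto simp: epr_amplitude_def)
  then show ?thesis using assms False by (simp add: epr_pairs_def)
qed

lemma epr_density_dens:
  "epr_density m = dens (2 ^ m) (2 ^ m) [((1 / complex_of_real (sqrt 2)) ^ m) \<cdot>\<^sub>m 1\<^sub>m (2 ^ m)]"
  unfolding epr_density_def
  by (intro eq_matI) (auto simp: dens_index epr_pairs_index less_mult_imp_div_less)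

lemma epr_density_smult:
  "epr_density m = (1 / 2 ^ m) \<cdot>\<^sub>m dens (2 ^ m) (2 ^ m) [1\<^sub>m (2 ^ m)]"
proof -
  have "(1 / complex_of_real (sqrt 2)) ^ m * cnj ((1 / complex_of_real (sqrt 2)) ^ m) = 1 / 2 ^ m"
    by (simp add: power_divide flip: power_mult_distrib of_real_mult)
  then show ?thesis
    unfolding epr_density_dens
    by (intro eq_matI) (auto simp: dens_index less_mult_imp_div_less simp del: complex_cnj_power)
qed

lemma mat_trace_dens_one: "mat_trace (dens d d [1\<^sub>m d]) = of_nat d"
proof -
  have "mat_trace (dens d d [1\<^sub>m d]) = (\<Sum>k<d * d. if k div d = k mod d then 1 else 0)"
    unfolding mat_trace_def dens_index(2)
  proof (intro sum.cong refl)
    fix k assume "k \<in> {..<d * d}"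
    then have "k < d * d" "k div d < d" "0 < d" by (auto simp: less_mult_imp_div_less intro: Nat.gr0I)
    then show "dens d d [1\<^sub>m d] $$ (k, k) = (if k div d = k mod d then 1 else 0)"
      by (auto simp: dens_index)
  qed
  also have "\<dots> = (\<Sum>x<d. \<Sum>y<d. if x = y then 1 else 0)" by (rule sum_div_mod)
  finally show ?thesis by simp
qed

lemma mspan_smult: "X \<in> mspan d S \<Longrightarrow> S \<subseteq> carrier_mat d d \<Longrightarrow> c \<cdot>\<^sub>m X \<in> mspan d S"
proof (induction rule: mspan.induct)
  case zero
  then show ?case by (simp add: mspan.zero)
next
  case (add X A e)
  then have "X \<in> carrier_mat d d" "A \<in> carrier_mat d d" using mspan_carrier by blast+
  then have "c \<cdot>\<^sub>m (X + e \<cdot>\<^sub>m A) = c \<cdot>\<^sub>m X + (c * e) \<cdot>\<^sub>m A" by (simp add: mat_algebra)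
  then show ?case using mspan.add add by metis
qed

text \<open>The initial state is a multiple of the identity operator, so after the channel the list
  consists of the Kraus operators themselves up to a scalar, and these expand into Pauli errors
  supported in \<open>T\<close>.\<close>

lemma noisy_pairs_dens:
  assumes T: "T \<subseteq> {..<n}" "card T \<le> t"
  shows "\<exists>Xs. set Xs \<subseteq> mspan (2 ^ n) (errors n t) \<and> noisy_pairs n T Es = dens (2 ^ n) (2 ^ n) Xs"
proof -
  let ?d = "2 ^ n :: nat"
  let ?a = "(1 / complex_of_real (sqrt 2)) ^ n"
  let ?Bs = "map (on_qubits n T) Es"
  have Bs: "on_qubits n T E \<in> carrier_mat ?d ?d" for E by (simp add: on_qubits_def)
  have ec: "errors n t \<subseteq> carrier_mat ?d ?d" unfolding errors_def by auto
  have "noisy_pairs n T Es = apply_kraus (?d * ?d) (map (tensor_mat (1\<^sub>m ?d)) ?Bs) (dens ?d ?d [?a \<cdot>\<^sub>m 1\<^sub>m ?d])"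
    unfolding noisy_pairs_def epr_density_dens by (simp add: comp_def)
  also have "\<dots> = dens ?d ?d (map (\<lambda>B. B * (?a \<cdot>\<^sub>m 1\<^sub>m ?d)) ?Bs)"
    by (rule apply_kraus_Bob) (use Bs in auto)
  finally have eq: "noisy_pairs n T Es = dens ?d ?d (map (\<lambda>B. B * (?a \<cdot>\<^sub>m 1\<^sub>m ?d)) ?Bs)" .
  have "on_qubits n T E * (?a \<cdot>\<^sub>m 1\<^sub>m ?d) \<in> mspan ?d (errors n t)" for E
  proof -
    have sub: "pauli n u v \<in> errors n t" if "u \<in> masks T" "v \<in> masks T" for u v
    proof -
      have s: "{q. bit u q \<or> bit v q} \<subseteq> T" using that by (auto simp: masks_def)
      have "card {q. bit u q \<or> bit v q} \<le> card T"
        by (rule card_mono[OF _ s]) (use T finite_subset in blast)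
      then show ?thesis using s T unfolding errors_def by fastforce
    qed
    have "on_qubits n T E \<in> mspan ?d (errors n t)"
    proof (rule mspan_subset[OF on_qubits_mspan[OF T(1)]])
      fix A assume "A \<in> {pauli n u v |u v. u \<in> masks T \<and> v \<in> masks T}"
      then have "A \<in> errors n t" using sub by blast
      then show "\<exists>B\<in>errors n t. \<exists>c. A = c \<cdot>\<^sub>m B"
        using smult_one[of A, symmetric] by (intro bexI[of _ A] exI[of _ 1])
    qed
    then have "?a \<cdot>\<^sub>m on_qubits n T E \<in> mspan ?d (errors n t)" using mspan_smult ec by blast
    moreover have "on_qubits n T E * (?a \<cdot>\<^sub>m 1\<^sub>m ?d) = ?a \<cdot>\<^sub>m on_qubits n T E"
      using Bs[of E] by (simp add: mult_smult)
    ultimately show ?thesis by simp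
  qed
  then show ?thesis using eq by (intro exI[of _ "map (\<lambda>B. B * (?a \<cdot>\<^sub>m 1\<^sub>m ?d)) ?Bs"]) auto
qed

theorem corollary3:
  fixes n t :: nat
  assumes "n \<ge> 1"
  shows "\<exists>k P. two_way_epp n P \<and> produces_epr P n t k \<and>
    real k \<ge> real n - log 2 (\<Sum>j=0..t. 3 ^ j * real (n choose j)) - 2"
proof -
  define M where "M = (\<Sum>j=0..t. 3 ^ j * (n choose j))"
  have "3 ^ 0 * (n choose 0) \<le> M" unfolding M_def by (rule member_le_sum) auto
  then have M: "1 \<le> M" by simp
  obtain a where a: "2 ^ a \<le> M" "M < 2 ^ (a + 1)" using ex_power_ivl1[of 2 M] M by auto
  \<comment> \<open>One more than a + 1, the exponent that bounds M: \<open>capacity s\<close> is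
    known to reach only 2^(s-1) = 2^(a+1).\<close>
  define s where "s = a + 2"
  have "card (errors n t) \<le> M" unfolding M_def by (rule card_errors)
  also have "\<dots> \<le> 2 ^ (s - 1)" using a by (simp add: s_def)
  also have "\<dots> \<le> capacity s" by (rule capacity_ge) (simp add: s_def)
  finally obtain P where P: "resolves n (errors n t) s P"
    using resolves_exists[OF error_group_pauli errors_subset] by blast
  have "two_way_epp n P" using P by (simp add: resolves_def two_way_epp_def)
  \<comment> \<open>The subtraction is truncated: for s > n this is the trivial claim with 0 pairs,
    and the required bound on \<open>k\<close> is then negative or zero.\<close>
  moreover have "produces_epr P n t (n - s)"
    unfolding produces_epr_def
  proof (intro allI impI ballI, clarify)
    fix T Es m \<sigma>
    assume T: "T \<subseteq> {..<n}" "card T \<le> t"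
      and r: "(m, \<sigma>) \<in> results P (2 ^ n) (2 ^ n) (noisy_pairs n T Es)" and tr: "mat_trace \<sigma> \<noteq> 0"
    obtain Xs where Xs: "set Xs \<subseteq> mspan (2 ^ n) (errors n t)" "noisy_pairs n T Es = dens (2 ^ n) (2 ^ n) Xs"
      using noisy_pairs_dens[OF T] by blast
    obtain c where m: "n \<le> m + s" and \<sigma>: "\<sigma> = c \<cdot>\<^sub>m dens (2 ^ m) (2 ^ m) [1\<^sub>m (2 ^ m)]"
      using P Xs r unfolding resolves_def by fastforce
    have "mat_trace \<sigma> = c * mat_trace (dens (2 ^ m) (2 ^ m) [1\<^sub>m (2 ^ m)])"
      unfolding \<sigma> mat_trace_def by (simp add: dens_index(2,3) sum_distrib_left)
    then have tr': "mat_trace \<sigma> = c * 2 ^ m" by (simp add: mat_trace_dens_one)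
    have "inverse (mat_trace \<sigma>) \<cdot>\<^sub>m \<sigma> = (inverse (c * 2 ^ m) * c) \<cdot>\<^sub>m dens (2 ^ m) (2 ^ m) [1\<^sub>m (2 ^ m)]"
      unfolding tr' unfolding \<sigma> smult_smult ..
    \<comment> \<open>A branch of non-zero probability has c \<noteq> 0, so normalization removes
      the unknown scalar.\<close>
    also have "inverse (c * 2 ^ m) * c = 1 / 2 ^ m" using tr tr' by (simp add: field_simps)
    finally show "n - s \<le> m \<and> inverse (mat_trace \<sigma>) \<cdot>\<^sub>m \<sigma> = epr_density m"
      using m by (simp add: epr_density_smult)
  qed
  moreover have "real (n - s) \<ge> real n - log 2 (\<Sum>j=0..t. 3 ^ j * real (n choose j)) - 2"
  proof -
    have "real M = (\<Sum>j=0..t. 3 ^ j * real (n choose j))" by (simp add: M_def)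
    moreover have "real a \<le> log 2 (real M)"
      using a(1) M by (subst le_log_iff) (simp_all add: powr_realpow flip: of_nat_power)
    ultimately show ?thesis by (simp add: s_def)
  qed
  ultimately show ?thesis by blast
qed

end
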